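(* Assume CH. Then Namba forcing is hemi-proper.
   Context: Let $S=\bigcup\{{}^n\omega_2 : n\in\omega\}$. Namba forcing is the poset of all non-empty $T\subseteq S$ such that $(\forall\eta\in T)(\forall\tau\subseteq\eta)(\tau\in T)$ and for every $\eta\in T$ there are $\aleph_2$-many $\tau\in T$ with $\tau\supseteq\eta$, ordered by inclusion (smaller sets are stronger). $H_\lambda$ is the collection of sets hereditarily of cardinality less than $\lambda$; $G_P$ is the canonical name for the generic filter on $P$. A poset $P$ is hemi-proper iff whenever $\lambda$ is a sufficiently large regular cardinal, $M$ and $N$ are countable elementary substructures of $H_\lambda$, $P\in M\in N$, and $q\in P\cap M$, then $q\not\Vdash$ "$\omega_1\cap M[G_P]>\omega_1\cap N$" (that is, $q$ does not force this statement; the two sets are compared as ordinals). *)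

theory Defs
  imports "HOL-Library.Equipollence" "HOL-Library.Multiset" "HOL-Library.Countable_Set"
begin

text \<open>
  The universe of sets is a type satisfying the second-order ZFC axioms, with \<open>elts x\<close> the HOL set
  of elements of \<open>x\<close> and \<open>range elts\<close> the HOL sets that are sets rather than proper classes.
  These are the axioms of the AFP entry \<open>ZFC_in_HOL\<close>, stated as a type class
  (the axiom of choice is inherited from HOL).
\<close>

class zfc_universe =
  fixes elts :: "'a \<Rightarrow> 'a set"
  assumes extensionality: "elts x = elts y \<Longrightarrow> x = y"
    and foundation: "wf {(x, y). x \<in> elts y}"
    and separation: "X \<subseteq> elts x \<Longrightarrow> X \<in> range elts"
    and union: "(\<Union>y\<in>elts x. elts y) \<in> range elts"
    and powerset: "{y. elts y \<subseteq> elts x} \<in> range elts"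
    and replacement: "f ` elts x \<in> range elts"
    and infinity: "range (g :: nat \<Rightarrow> 'a) \<in> range elts"

definition memrel :: "('v::zfc_universe \<times> 'v) set" where
  "memrel = {(x, y). x \<in> elts y}"

text \<open>Only meaningful for \<open>X \<in> range elts\<close>.\<close>

definition vset :: "'v set \<Rightarrow> 'v::zfc_universe" where
  "vset X = (THE x. elts x = X)"

definition vpair :: "'v \<Rightarrow> 'v \<Rightarrow> 'v::zfc_universe" where
  "vpair a b = vset {vset {a}, vset {a, b}}"

lemma elts_vset: "X \<in> range elts \<Longrightarrow> elts (vset X) = X"
proof -
  assume "X \<in> range elts"
  then obtain x where x: "elts x = X" by auto
  have "vset X = x"
    unfolding vset_def using x by (intro the_equality) (simp_all add: extensionality)
  then show ?thesis using x by simp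
qed

lemma small_upair: "{a, b} \<in> range (elts :: 'v \<Rightarrow> 'v::zfc_universe set)"
proof -
  have "range (\<lambda>n::nat. if n = 0 then a else b) = {a, b}"
    by (auto simp: image_def intro: exI[of _ "1::nat"])
  then show ?thesis using infinity[of "\<lambda>n::nat. if n = 0 then a else b"] by simp
qed

lemma small_singleton: "{a} \<in> range (elts :: 'v \<Rightarrow> 'v::zfc_universe set)"
  using small_upair[of a a] by simp

lemma elts_vpair: "elts (vpair a b) = {vset {a}, vset {a, b}}"
  unfolding vpair_def by (rule elts_vset[OF small_upair])

lemma vpair_inject [simp]: "vpair a b = vpair c d \<longleftrightarrow> a = c \<and> b = d"
proof
  assume "vpair a b = vpair c d"
  then have "{vset {a}, vset {a, b}} = {vset {c}, vset {c, d}}"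
    by (metis elts_vpair)
  then have "elts ` {vset {a}, vset {a, b}} = elts ` {vset {c}, vset {c, d}}"
    by simp
  then have "{{a}, {a, b}} = {{c}, {c, d}}"
    by (simp add: elts_vset small_upair small_singleton)
  then show "a = c \<and> b = d" by (auto simp: doubleton_eq_iff)
qed simp

lemma wf_memrel: "wf memrel"
  unfolding memrel_def by (rule foundation)

lemma vpair_fst_memrel: "vpair a b \<in> elts x \<Longrightarrow> (a, x) \<in> memrel\<^sup>+"
proof -
  assume x: "vpair a b \<in> elts x"
  have "(a, vset {a}) \<in> memrel"
    by (simp add: memrel_def elts_vset[OF small_singleton])
  moreover have "(vset {a}, vpair a b) \<in> memrel"
    by (simp add: memrel_def elts_vpair)
  moreover have "(vpair a b, x) \<in> memrel"
    using x by (simp add: memrel_def)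
  ultimately show ?thesis
    by (meson r_into_trancl trancl_into_trancl)
qed


subsection \<open>Ordinals and cardinals\<close>

definition transitive_set :: "'v::zfc_universe \<Rightarrow> bool" where
  "transitive_set x \<longleftrightarrow> (\<forall>y\<in>elts x. elts y \<subseteq> elts x)"

definition Ord :: "'v::zfc_universe \<Rightarrow> bool" where
  "Ord \<alpha> \<longleftrightarrow> transitive_set \<alpha> \<and> (\<forall>\<beta>\<in>elts \<alpha>. transitive_set \<beta>)"

definition cardinal :: "'v::zfc_universe \<Rightarrow> bool" where
  "cardinal \<kappa> \<longleftrightarrow> Ord \<kappa> \<and> (\<forall>\<alpha>\<in>elts \<kappa>. \<not> elts \<alpha> \<approx> elts \<kappa>)"

definition regular :: "'v::zfc_universe \<Rightarrow> bool" where
  "regular \<kappa> \<longleftrightarrow> cardinal \<kappa> \<and> infinite (elts \<kappa>) \<and>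
     (\<forall>X\<subseteq>elts \<kappa>. (\<forall>\<alpha>\<in>elts \<kappa>. \<exists>\<beta>\<in>X. elts \<alpha> \<subseteq> elts \<beta>) \<longrightarrow> X \<approx> elts \<kappa>)"

primrec vnat :: "nat \<Rightarrow> 'v::zfc_universe" where
  "vnat 0 = vset {}"
| "vnat (Suc n) = vset (insert (vnat n) (elts (vnat n)))"

definition succ_card :: "'v::zfc_universe \<Rightarrow> 'v" where
  "succ_card \<kappa> = (THE \<mu>. cardinal \<mu> \<and> \<kappa> \<in> elts \<mu> \<and>
     (\<forall>\<nu>. cardinal \<nu> \<and> \<kappa> \<in> elts \<nu> \<longrightarrow> elts \<mu> \<subseteq> elts \<nu>))"

primrec aleph :: "nat \<Rightarrow> 'v::zfc_universe" where
  "aleph 0 = vset (range vnat)"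
| "aleph (Suc n) = succ_card (aleph n)"


subsection \<open>Elementary substructures of \<open>H\<^sub>\<lambda>\<close>\<close>

text \<open>\<open>x \<in> H\<^sub>\<lambda>\<close> iff the transitive closure of \<open>x\<close> has cardinality less than \<open>\<lambda>\<close>.\<close>

definition H :: "'v::zfc_universe \<Rightarrow> 'v set" where
  "H \<kappa> = {x. {y. (y, x) \<in> memrel\<^sup>+} \<prec> elts \<kappa>}"

datatype fm = Mem nat nat | Eq nat nat | Neg fm | And fm fm | All nat fm

abbreviation Exists :: "nat \<Rightarrow> fm \<Rightarrow> fm" where
  "Exists n \<phi> \<equiv> Neg (All n (Neg \<phi>))"

abbreviation Iff :: "fm \<Rightarrow> fm \<Rightarrow> fm" where
  "Iff \<phi> \<psi> \<equiv> And (Neg (And \<phi> (Neg \<psi>))) (Neg (And \<psi> (Neg \<phi>)))"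

primrec sat :: "'v::zfc_universe set \<Rightarrow> fm \<Rightarrow> (nat \<Rightarrow> 'v) \<Rightarrow> bool" where
  "sat A (Mem i j) e \<longleftrightarrow> e i \<in> elts (e j)"
| "sat A (Eq i j) e \<longleftrightarrow> e i = e j"
| "sat A (Neg \<phi>) e \<longleftrightarrow> \<not> sat A \<phi> e"
| "sat A (And \<phi> \<psi>) e \<longleftrightarrow> sat A \<phi> e \<and> sat A \<psi> e"
| "sat A (All i \<phi>) e \<longleftrightarrow> (\<forall>x\<in>A. sat A \<phi> (e(i := x)))"

definition elementary :: "'v::zfc_universe set \<Rightarrow> 'v set \<Rightarrow> bool" where
  "elementary A B \<longleftrightarrow> A \<noteq> {} \<and> A \<subseteq> B \<and>
     (\<forall>\<phi> e. range e \<subseteq> A \<longrightarrow> (sat A \<phi> e \<longleftrightarrow> sat B \<phi> e))"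


subsection \<open>Forcing\<close>

text \<open>
  A poset is an ordered pair \<open>P = (carrier, order)\<close> in the universe; \<open>leq P q p\<close> says that \<open>q\<close> is
  stronger than or equal to \<open>p\<close>.
\<close>

definition conds :: "'v::zfc_universe \<Rightarrow> 'v set" where
  "conds P = elts (THE A. \<exists>R. P = vpair A R)"

definition leq :: "'v::zfc_universe \<Rightarrow> 'v \<Rightarrow> 'v \<Rightarrow> bool" where
  "leq P q p \<longleftrightarrow> q \<in> conds P \<and> p \<in> conds P \<and> vpair q p \<in> elts (THE R. \<exists>A. P = vpair A R)"

definition poset :: "'v::zfc_universe \<Rightarrow> bool" where
  "poset P \<longleftrightarrow> (\<exists>A R. P = vpair A R \<and> elts R \<subseteq> {vpair q p |q p. q \<in> elts A \<and> p \<in> elts A}) \<and>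
     (\<forall>p\<in>conds P. leq P p p) \<and>
     (\<forall>p q r. leq P p q \<longrightarrow> leq P q r \<longrightarrow> leq P p r) \<and>
     (\<forall>p q. leq P p q \<longrightarrow> leq P q p \<longrightarrow> p = q)"

inductive is_name :: "'v::zfc_universe \<Rightarrow> 'v \<Rightarrow> bool" for P where
  "(\<And>z. z \<in> elts x \<Longrightarrow> \<exists>y p. z = vpair y p \<and> p \<in> conds P \<and> is_name P y) \<Longrightarrow> is_name P x"

lemma mult_pair_less:
  assumes "(a, b) \<in> memrel\<^sup>+"
  shows "({#a, c#}, {#b, c#}) \<in> mult (memrel\<^sup>+)"
    and "({#a, c#}, {#c, b#}) \<in> mult (memrel\<^sup>+)"
    and "({#c, a#}, {#c, b#}) \<in> mult (memrel\<^sup>+)"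
  using one_step_implies_mult[of "{#b#}" "{#a#}" "memrel\<^sup>+" "{#c#}"] assms
  by (simp_all add: add_mset_commute)

text \<open>The forcing relation on atomic formulas, by the usual simultaneous recursion on names.\<close>

context
  notes conj_cong [fundef_cong]
begin

function forces_eq :: "'v::zfc_universe \<Rightarrow> 'v \<Rightarrow> 'v \<Rightarrow> 'v \<Rightarrow> bool"
  and forces_mem :: "'v \<Rightarrow> 'v \<Rightarrow> 'v \<Rightarrow> 'v \<Rightarrow> bool" where
  "forces_eq P p \<pi> \<tau> \<longleftrightarrow>
     (\<forall>\<sigma> s. vpair \<sigma> s \<in> elts \<pi> \<longrightarrow> (\<forall>q. leq P q p \<and> leq P q s \<longrightarrow> forces_mem P q \<sigma> \<tau>)) \<and>
     (\<forall>\<sigma> s. vpair \<sigma> s \<in> elts \<tau> \<longrightarrow> (\<forall>q. leq P q p \<and> leq P q s \<longrightarrow> forces_mem P q \<sigma> \<pi>))"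
| "forces_mem P p \<pi> \<tau> \<longleftrightarrow>
     (\<forall>q. leq P q p \<longrightarrow> (\<exists>r \<sigma> s. vpair \<sigma> s \<in> elts \<tau> \<and> leq P r q \<and> leq P r s \<and> forces_eq P r \<pi> \<sigma>))"
  by pat_completeness auto

termination
  apply (relation "inv_image (mult (memrel\<^sup>+))
      (\<lambda>z. case z of Inl (P, p, x, y) \<Rightarrow> {#x, y#} | Inr (P, p, x, y) \<Rightarrow> {#x, y#})")
     apply (intro wf_inv_image wf_mult wf_trancl wf_memrel)
    apply (simp add: mult_pair_less vpair_fst_memrel)
   apply (simp add: mult_pair_less vpair_fst_memrel)
  apply (simp add: mult_pair_less vpair_fst_memrel)
  done

end

declare forces_eq.simps [simp del] forces_mem.simps [simp del]

text \<open>The environment assigns names to the free variables.\<close>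

primrec forces :: "'v::zfc_universe \<Rightarrow> 'v \<Rightarrow> fm \<Rightarrow> (nat \<Rightarrow> 'v) \<Rightarrow> bool" where
  "forces P p (Mem i j) e \<longleftrightarrow> forces_mem P p (e i) (e j)"
| "forces P p (Eq i j) e \<longleftrightarrow> forces_eq P p (e i) (e j)"
| "forces P p (Neg \<phi>) e \<longleftrightarrow> (\<forall>q. leq P q p \<longrightarrow> \<not> forces P q \<phi> e)"
| "forces P p (And \<phi> \<psi>) e \<longleftrightarrow> forces P p \<phi> e \<and> forces P p \<psi> e"
| "forces P p (All i \<phi>) e \<longleftrightarrow> (\<forall>\<tau>. is_name P \<tau> \<longrightarrow> forces P p \<phi> (e(i := \<tau>)))"

text \<open>
  Posets need not have a largest element, so the names of ground-model sets (and the name of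
  \<open>M[G]\<close>) carry every condition where one usually takes only the largest one.
\<close>

function check :: "'v::zfc_universe \<Rightarrow> 'v \<Rightarrow> 'v" where
  "check P x = vset (\<Union>y\<in>elts x. vpair (check P y) ` conds P)"
  by pat_completeness auto
termination
  by (relation "inv_image memrel snd") (simp_all add: wf_memrel, simp add: memrel_def)

declare check.simps [simp del]

definition gen_ext_name :: "'v::zfc_universe \<Rightarrow> 'v \<Rightarrow> 'v" where
  "gen_ext_name P M = vset {vpair \<tau> p |\<tau> p. \<tau> \<in> elts M \<and> is_name P \<tau> \<and> p \<in> conds P}"

text \<open>
  In \<open>hemi_proper\<close>, \<open>\<omega>\<^sub>1\<close> is that of the ground model.  The forced formula says that some
  \<open>a = \<omega>\<^sub>1 \<inter> M[G]\<close> has \<open>\<omega>\<^sub>1 \<inter> N\<close> as an element, which is \<open>a > \<omega>\<^sub>1 \<inter> N\<close> for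
  von Neumann ordinals: variable 0 stands for \<open>\<omega>\<^sub>1 \<inter> N\<close>, variable 1 for \<open>\<omega>\<^sub>1\<close>, variable 2 for
  \<open>M[G]\<close>.
\<close>

definition exceeds_fm :: fm where
  "exceeds_fm = Exists 3 (And (All 4 (Iff (Mem 4 3) (And (Mem 4 1) (Mem 4 2)))) (Mem 0 3))"

definition exceeds_env :: "'v::zfc_universe \<Rightarrow> 'v \<Rightarrow> 'v \<Rightarrow> nat \<Rightarrow> 'v" where
  "exceeds_env P M N i =
     (if i = 0 then check P (vset (elts (aleph 1) \<inter> elts N))
      else if i = 1 then check P (aleph 1)
      else gen_ext_name P M)"

definition hemi_proper :: "'v::zfc_universe \<Rightarrow> bool" where
  "hemi_proper P \<longleftrightarrow> poset P \<and>
     (\<exists>\<kappa>. cardinal \<kappa> \<and>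
       (\<forall>\<theta>. regular \<theta> \<and> \<kappa> \<in> elts \<theta> \<longrightarrow>
         (\<forall>M N q. countable (elts M) \<and> countable (elts N) \<and>
            elementary (elts M) (H \<theta>) \<and> elementary (elts N) (H \<theta>) \<and>
            P \<in> elts M \<and> M \<in> elts N \<and> q \<in> conds P \<inter> elts M
          \<longrightarrow> \<not> forces P q exceeds_fm (exceeds_env P M N))))"


subsection \<open>Namba forcing\<close>

definition funs :: "'v::zfc_universe \<Rightarrow> 'v \<Rightarrow> 'v set" where
  "funs A B = {f. elts f \<subseteq> {vpair a b |a b. a \<in> elts A \<and> b \<in> elts B} \<and>
                  (\<forall>a\<in>elts A. \<exists>!b. vpair a b \<in> elts f)}"

definition fin_seqs :: "'v::zfc_universe set" where
  "fin_seqs = (\<Union>n\<in>elts (aleph 0). funs n (aleph 2))"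

definition namba_trees :: "'v::zfc_universe set" where
  "namba_trees = {T. elts T \<noteq> {} \<and> elts T \<subseteq> fin_seqs \<and>
     (\<forall>\<eta>\<in>elts T. \<forall>\<tau>\<in>fin_seqs. elts \<tau> \<subseteq> elts \<eta> \<longrightarrow> \<tau> \<in> elts T) \<and>
     (\<forall>\<eta>\<in>elts T. {\<tau> \<in> elts T. elts \<eta> \<subseteq> elts \<tau>} \<approx> elts (aleph 2 :: 'v))}"

definition namba :: "'v::zfc_universe" where
  "namba = vpair (vset namba_trees)
     (vset {vpair T' T |T' T. T' \<in> namba_trees \<and> T \<in> namba_trees \<and> elts T' \<subseteq> elts T})"

end

theory Submission
  imports Defs
begin

text \<open>
  Hemi-properness is a consequence of the preservation of \<open>\<omega>\<^sub>1\<close>: the names in \<open>M\<close> form a countable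
  family belonging to \<open>N\<close>, so if some \<open>T \<le> q\<close> bounds by one \<open>\<delta> < \<omega>\<^sub>1\<close> all the countable ordinals that they
  may denote, then by elementarity there is such a \<open>\<delta>\<close> in \<open>N\<close>, and \<open>T\<close> forces \<open>\<omega>\<^sub>1 \<inter> N > \<delta>\<close> not to be in \<open>M[G]\<close>.

  For the bound, shrink \<open>q\<close> successively to trees deciding the \<open>n\<close>-th name, branching at each step over
  a family of \<open>\<aleph>\<^sub>2\<close> pairwise incomparable nodes. For \<open>\<delta> < \<omega>\<^sub>1\<close> consider the game in which one player discards \<open>\<aleph>\<^sub>1\<close> of
  the branches and the other moves to a remaining one, keeping the decided values below \<open>\<delta>\<close>. If the
  second player does not lose for some \<open>\<delta>\<close>, the positions that are not lost form the desired tree. Otherwise the first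
  player wins for every \<open>\<delta>\<close>; since \<open>\<aleph>\<^sub>1\<close> many sets of size \<open>\<aleph>\<^sub>1\<close> do not exhaust \<open>\<aleph>\<^sub>2\<close> branches, a single run
  plays against all these strategies at once, and its countably many values are bounded by some
  \<open>\<delta> < \<omega>\<^sub>1\<close>, for which the first player then fails to win.
\<close>


subsection \<open>Sets\<close>

text \<open>A fusion alone does not bound a name: the decided value varies with the node, and the
  values at aleph_2 many nodes may be cofinal in omega_1. The game trades them for a single bound;
  only branches, which are countable, have one for free. Elements of \<open>M\<close> need not name
  ordinals, so deciding is weakened: at most one countable ordinal can be forced equal to the name.
  The bound uses no generic filter and no truth lemma, only that forced equality is an equivalence
  relation, passes to stronger conditions, and separates check names of distinct sets. Elementarity
  needs the existence of a bound as one formula with parameters in \<open>N\<close>, but the forcing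
  relation is a recursion in HOL. Sets satisfying the relevant recursions on a large enough
  transitive set serve as parameters, and must themselves first be found in
  \<open>N\<close>.\<close>

definition small :: "'v::zfc_universe set \<Rightarrow> bool" where
  "small X \<longleftrightarrow> X \<in> range elts"

lemma small_elts [simp]: "small (elts x)"
  unfolding small_def by blast

lemma elts_vset_small: "small X \<Longrightarrow> elts (vset X) = X"
  unfolding small_def by (rule elts_vset)

lemma smallE: "small X \<Longrightarrow> (\<And>x. X = elts x \<Longrightarrow> thesis) \<Longrightarrow> thesis"
  unfolding small_def by blast

lemma small_subset: "small X \<Longrightarrow> Y \<subseteq> X \<Longrightarrow> small Y"
  unfolding small_def using separation by blast

lemma small_image: "small (X :: 'v::zfc_universe set) \<Longrightarrow> small ((f :: 'v \<Rightarrow> 'v) ` X)"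
  by (elim smallE, hypsubst, unfold small_def, rule replacement)

lemma small_lepoll: "X \<lesssim> elts (x :: 'v) \<Longrightarrow> small (X :: 'v::zfc_universe set)"
  unfolding lepoll_iff by (elim exE) (rule small_subset[OF small_image[OF small_elts]])

lemma small_doubleton [simp]: "small {a, b}"
  unfolding small_def by (rule small_upair)

lemma small_countable: "countable X \<Longrightarrow> small (X :: 'v::zfc_universe set)"
proof (cases "X = {}")
  case True
  then show ?thesis using small_subset[OF small_doubleton] by blast
next
  case False
  assume "countable X"
  then show ?thesis
    using infinity[of "from_nat_into X"] range_from_nat_into[OF False] by (simp add: small_def)
qed

lemma small_UN:
  fixes X :: "'v::zfc_universe set" and F :: "'v \<Rightarrow> 'v set"
  assumes "small X" "\<And>x. x \<in> X \<Longrightarrow> small (F x)"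
  shows "small (\<Union>x\<in>X. F x)"
proof -
  obtain z where z: "elts z = (\<lambda>x. vset (F x)) ` X"
    using small_image[OF assms(1), of "\<lambda>x. vset (F x)"] by (metis smallE)
  have "(\<Union>y\<in>elts z. elts y) = (\<Union>x\<in>X. F x)"
    using assms(2) by (simp add: z elts_vset_small)
  then show ?thesis using union[of z] by (simp add: small_def)
qed

lemma small_Un: "small X \<Longrightarrow> small Y \<Longrightarrow> small (X \<union> Y)"
  using small_UN[of "{vset X, vset Y}" elts] by (auto simp: elts_vset_small)

lemma small_insert: "small X \<Longrightarrow> small (insert a X)"
  using small_Un[OF small_doubleton[of a a], of X] by simp

lemma small_Pow: "small X \<Longrightarrow> small {y. elts y \<subseteq> X}"
  by (elim smallE, hypsubst, unfold small_def, rule powerset)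

lemma small_pairs:
  assumes "small X" "small Y"
  shows "small {vpair a b |a b. a \<in> X \<and> b \<in> Y}"
proof -
  have "{vpair a b |a b. a \<in> X \<and> b \<in> Y} = (\<Union>a\<in>X. vpair a ` Y)" by auto
  then show ?thesis using assms by (simp add: small_UN small_image)
qed

lemma mem_induct [case_names mem]:
  "(\<And>x. (\<And>y. y \<in> elts x \<Longrightarrow> Q y) \<Longrightarrow> Q x) \<Longrightarrow> Q (x::'v::zfc_universe)"
  by (rule wf_induct_rule[OF foundation]) simp

lemma mem_not_refl: "x \<notin> elts x"
  by (induct x rule: mem_induct) blast

lemma mem_not_sym: "x \<in> elts y \<Longrightarrow> y \<notin> elts x"
  by (induct x arbitrary: y rule: mem_induct) blast



subsection \<open>Ordinals\<close>

lemma Ord_mem: "Ord a \<Longrightarrow> b \<in> elts a \<Longrightarrow> Ord b"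
  unfolding Ord_def transitive_set_def by blast

lemma Ord_mem_subset: "Ord a \<Longrightarrow> b \<in> elts a \<Longrightarrow> elts b \<subseteq> elts a"
  unfolding Ord_def transitive_set_def by blast

lemma Ord_linear: "Ord a \<Longrightarrow> Ord b \<Longrightarrow> a \<in> elts b \<or> a = b \<or> b \<in> elts a"
proof (induct a arbitrary: b rule: mem_induct)
  case (mem a)
  note IHa = mem
  from \<open>Ord b\<close> show ?case
  proof (induct b rule: mem_induct)
    case (mem b)
    show ?case
    proof (rule ccontr)
      assume c: "\<not> ?case"
      have "x \<in> elts b" if "x \<in> elts a" for x
        using IHa(1)[OF that Ord_mem[OF IHa(2) that] mem(2)] Ord_mem_subset[OF IHa(2) that] c that
        by blast
      moreover have "x \<in> elts a" if "x \<in> elts b" for x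
        using mem(1)[OF that Ord_mem[OF mem(2) that]] Ord_mem_subset[OF mem(2) that] c that
        by blast
      ultimately have "a = b" by (intro extensionality) blast
      then show False using c by blast
    qed
  qed
qed

lemma Ord_not_mem: "Ord a \<Longrightarrow> Ord b \<Longrightarrow> a \<notin> elts b \<Longrightarrow> elts b \<subseteq> elts a"
  using Ord_linear Ord_mem_subset by blast

lemma Ord_vset:
  assumes "small X" "\<And>x. x \<in> X \<Longrightarrow> Ord x \<and> elts x \<subseteq> X"
  shows "Ord (vset X)"
  using assms unfolding Ord_def transitive_set_def by (simp add: elts_vset_small)

text \<open>An ordinal that injects into \<open>\<kappa>\<close> is determined by the copy of its
  membership relation on \<open>\<kappa>\<close>. The copies lie in the power set of the square of
  \<open>\<kappa>\<close>; replacement along the inverse of the coding brings smallness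
  back.\<close>

lemma small_hartogs:
  fixes \<kappa> :: "'v::zfc_universe"
  shows "small {\<alpha>::'v. Ord \<alpha> \<and> elts \<alpha> \<lesssim> elts \<kappa>}"
proof -
  define h where "h = {\<alpha>::'v. Ord \<alpha> \<and> elts \<alpha> \<lesssim> elts \<kappa>}"
  have "\<exists>f. inj_on f (elts \<alpha>) \<and> f ` elts \<alpha> \<subseteq> elts \<kappa>" if "\<alpha> \<in> h" for \<alpha>
    using that unfolding h_def lepoll_def by simp
  then obtain f where f: "\<And>\<alpha>. \<alpha> \<in> h \<Longrightarrow> inj_on (f \<alpha>) (elts \<alpha>) \<and> f \<alpha> ` elts \<alpha> \<subseteq> elts \<kappa>"
    by metis
  define code where "code \<alpha> = {vpair (f \<alpha> x) (f \<alpha> y) |x y. x \<in> elts y \<and> y \<in> elts \<alpha>}" for \<alpha>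
  define Z where "Z = {vpair a b |a b. a \<in> elts \<kappa> \<and> b \<in> elts \<kappa>}"
  \<comment> \<open>The diagonal records the field of the relation; without it 0 and 1 would share
    the empty code.\<close>
  define all where "all \<alpha> = {vpair (f \<alpha> x) (f \<alpha> x) |x. x \<in> elts \<alpha>} \<union> code \<alpha>" for \<alpha>
  have allZ: "all \<alpha> \<subseteq> Z" if "\<alpha> \<in> h" for \<alpha>
  proof -
    have "f \<alpha> x \<in> elts \<kappa>" if "x \<in> elts \<alpha>" for x
      using f[OF \<open>\<alpha> \<in> h\<close>] that by blast
    moreover have "x \<in> elts \<alpha>" if "x \<in> elts y" "y \<in> elts \<alpha>" for x y
      using \<open>\<alpha> \<in> h\<close> that Ord_mem_subset unfolding h_def by blast
    ultimately show ?thesis unfolding all_def code_def Z_def by blast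
  qed
  have Zs: "small Z" unfolding Z_def by (intro small_pairs) auto
  have inj: "\<alpha> = \<beta>" if ab: "\<alpha> \<in> h" "\<beta> \<in> h" "all \<alpha> = all \<beta>" for \<alpha> \<beta>
  proof -
    \<comment> \<open>Points with the same label are equal: off the diagonal, the pairs ending in a
      label come from the elements of the point, to which the induction applies.\<close>
    have fa: "f \<alpha> x = f \<beta> x' \<Longrightarrow> x = x'" if "x \<in> elts \<alpha>" "x' \<in> elts \<beta>" for x x'
      using that
    proof (induct x arbitrary: x' rule: mem_induct)
      case (mem x)
      have oa: "Ord \<alpha>" "Ord \<beta>" using ab by (auto simp: h_def)
      have ia: "inj_on (f \<alpha>) (elts \<alpha>)" "inj_on (f \<beta>) (elts \<beta>)" using f ab by auto
      show ?case
      proof (rule extensionality, intro equalityI subsetI)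
        fix z assume z: "z \<in> elts x"
        then have za: "z \<in> elts \<alpha>" using Ord_mem_subset[OF oa(1) mem(3)] by blast
        have "vpair (f \<alpha> z) (f \<alpha> x) \<in> all \<beta>"
          using ab(3) z mem(3) unfolding all_def code_def by blast
        moreover have "f \<alpha> z \<noteq> f \<alpha> x" using ia(1) za mem(3) z mem_not_refl inj_on_eq_iff by metis
        ultimately obtain u v where u: "u \<in> elts v" "v \<in> elts \<beta>" "f \<alpha> z = f \<beta> u" "f \<alpha> x = f \<beta> v"
          unfolding all_def code_def by auto
        have ub: "u \<in> elts \<beta>" using u Ord_mem_subset[OF oa(2)] by blast
        have "v = x'" using u mem(2,4) ia(2) by (metis inj_on_eq_iff)
        moreover have "z = u" using mem(1)[OF z u(3) za ub] .
        ultimately show "z \<in> elts x'" using u by simp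
      next
        fix z assume z: "z \<in> elts x'"
        then have zb: "z \<in> elts \<beta>" using Ord_mem_subset[OF oa(2) mem(4)] by blast
        have "vpair (f \<beta> z) (f \<beta> x') \<in> all \<alpha>"
          using ab(3) z mem(4) unfolding all_def code_def by blast
        moreover have "f \<beta> z \<noteq> f \<beta> x'" using ia(2) zb mem(4) z mem_not_refl inj_on_eq_iff by metis
        ultimately obtain u v where u: "u \<in> elts v" "v \<in> elts \<alpha>" "f \<beta> z = f \<alpha> u" "f \<beta> x' = f \<alpha> v"
          unfolding all_def code_def by auto
        have ua: "u \<in> elts \<alpha>" using u Ord_mem_subset[OF oa(1)] by blast
        have "v = x" using u mem(2,3) ia(1) by (metis inj_on_eq_iff)
        moreover have "u = z" using mem(1)[of u z] u \<open>v = x\<close> ua zb by simp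
        ultimately show "z \<in> elts x" using u by simp
      qed
    qed
    have *: "x \<in> elts \<alpha> \<longleftrightarrow> x \<in> elts \<beta>" for x
    proof -
      have "x \<in> elts \<alpha> \<Longrightarrow> \<exists>x'\<in>elts \<beta>. f \<alpha> x = f \<beta> x'"
      proof -
        assume "x \<in> elts \<alpha>"
        then have "vpair (f \<alpha> x) (f \<alpha> x) \<in> all \<beta>" using ab(3) unfolding all_def by blast
        then show ?thesis unfolding all_def code_def by auto
      qed
      moreover have "x \<in> elts \<beta> \<Longrightarrow> \<exists>x'\<in>elts \<alpha>. f \<alpha> x' = f \<beta> x"
      proof -
        assume "x \<in> elts \<beta>"
        then have "vpair (f \<beta> x) (f \<beta> x) \<in> all \<alpha>" using ab(3) unfolding all_def by blast
        then show ?thesis unfolding all_def code_def by auto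
      qed
      ultimately show ?thesis using fa by blast
    qed
    then show ?thesis by (intro extensionality) blast
  qed
  let ?c = "\<lambda>\<alpha>. vset (all \<alpha>)"
  have ce: "elts (?c \<alpha>) = all \<alpha>" if "\<alpha> \<in> h" for \<alpha>
    using elts_vset_small small_subset[OF Zs allZ[OF that]] by blast
  have "inj_on ?c h"
    by (intro inj_onI) (metis ce inj)
  moreover have "small (?c ` h)"
    by (rule small_subset[OF small_Pow[OF Zs]]) (use ce allZ in auto)
  ultimately have "small h"
    using small_image[of "?c ` h" "inv_into h ?c"] by simp
  then show ?thesis by (simp add: h_def)
qed

text \<open>The ordinals that inject into \<open>\<kappa>\<close> form an ordinal (Hartogs). It does
  not inject into \<open>\<kappa>\<close>, as it would then be its own element. It lies inside every
  cardinal above \<open>\<kappa>\<close>, which identifies the \<open>THE\<close> in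
  \<open>succ_card\<close>.\<close>

lemma succ_card_props:
  fixes \<kappa> :: "'v::zfc_universe"
  assumes "Ord \<kappa>"
  shows elts_succ_card: "elts (succ_card \<kappa>) = {\<alpha>. Ord \<alpha> \<and> elts \<alpha> \<lesssim> elts \<kappa>}"
    and Ord_succ_card: "Ord (succ_card \<kappa>)"
    and cardinal_succ_card: "cardinal (succ_card \<kappa>)"
    and succ_card_not_lepoll: "\<not> elts (succ_card \<kappa>) \<lesssim> elts \<kappa>"
proof -
  define h :: 'v where "h = vset {\<alpha>. Ord \<alpha> \<and> elts \<alpha> \<lesssim> elts \<kappa>}"
  have eh: "elts h = {\<alpha>. Ord \<alpha> \<and> elts \<alpha> \<lesssim> elts \<kappa>}"
    unfolding h_def by (rule elts_vset_small[OF small_hartogs])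
  have oh: "Ord h" unfolding h_def
  proof (rule Ord_vset[OF small_hartogs], intro conjI subsetI)
    fix \<alpha> \<beta> assume a: "\<alpha> \<in> {\<alpha>. Ord \<alpha> \<and> elts \<alpha> \<lesssim> elts \<kappa>}"
    then show "Ord \<alpha>" by simp
    assume b: "\<beta> \<in> elts \<alpha>"
    then have "elts \<beta> \<subseteq> elts \<alpha>" using a Ord_mem_subset by blast
    then have "elts \<beta> \<lesssim> elts \<kappa>" using a lepoll_trans subset_imp_lepoll by blast
    then show "\<beta> \<in> {\<alpha>. Ord \<alpha> \<and> elts \<alpha> \<lesssim> elts \<kappa>}" using a b Ord_mem by blast
  qed
  have nl: "\<not> elts h \<lesssim> elts \<kappa>" using eh oh mem_not_refl by blast
  have ch: "cardinal h" unfolding cardinal_def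
    using oh nl eh lepoll_trans1 eqpoll_sym by blast
  have kh: "\<kappa> \<in> elts h" using eh assms by simp
  have least: "elts h \<subseteq> elts \<nu>" if n: "cardinal \<nu>" "\<kappa> \<in> elts \<nu>" for \<nu>
  proof
    fix \<alpha> assume a: "\<alpha> \<in> elts h"
    show "\<alpha> \<in> elts \<nu>"
    proof (rule ccontr)
      assume "\<alpha> \<notin> elts \<nu>"
      then have "elts \<nu> \<subseteq> elts \<alpha>" using Ord_not_mem a eh n(1) by (auto simp: cardinal_def)
      then have "elts \<nu> \<lesssim> elts \<kappa>" using a eh lepoll_trans subset_imp_lepoll by blast
      moreover have "elts \<kappa> \<lesssim> elts \<nu>" using n
        by (intro subset_imp_lepoll Ord_mem_subset) (auto simp: cardinal_def)
      ultimately show False using n lepoll_antisym unfolding cardinal_def by blast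
    qed
  qed
  have "succ_card \<kappa> = h" unfolding succ_card_def
  proof (rule the_equality)
    show "cardinal h \<and> \<kappa> \<in> elts h \<and> (\<forall>\<nu>. cardinal \<nu> \<and> \<kappa> \<in> elts \<nu> \<longrightarrow> elts h \<subseteq> elts \<nu>)"
      using ch kh least by blast
    fix \<mu> assume "cardinal \<mu> \<and> \<kappa> \<in> elts \<mu> \<and> (\<forall>\<nu>. cardinal \<nu> \<and> \<kappa> \<in> elts \<nu> \<longrightarrow> elts \<mu> \<subseteq> elts \<nu>)"
    then show "\<mu> = h" using ch kh least by (intro extensionality equalityI) auto
  qed
  then show "elts (succ_card \<kappa>) = {\<alpha>. Ord \<alpha> \<and> elts \<alpha> \<lesssim> elts \<kappa>}" "Ord (succ_card \<kappa>)"
    "cardinal (succ_card \<kappa>)" "\<not> elts (succ_card \<kappa>) \<lesssim> elts \<kappa>"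
    using eh oh ch nl by auto
qed

text \<open>\<open>\<pi>\<close> is the Mostowski collapse of \<open>Y\<close>; it is injective on
  \<open>Y\<close> because any two distinct ordinals are related by membership.\<close>

lemma Ord_eqpoll_subset:
  fixes Y :: "'v::zfc_universe set"
  assumes "\<And>y. y \<in> Y \<Longrightarrow> Ord y" "small Y"
  shows "\<exists>\<alpha>::'v. Ord \<alpha> \<and> elts \<alpha> \<approx> Y"
proof -
  define \<pi> :: "'v \<Rightarrow> 'v" where "\<pi> = wfrec memrel (\<lambda>g y. vset (g ` (Y \<inter> elts y)))"
  have pi: "\<pi> y = vset (\<pi> ` (Y \<inter> elts y))" for y
    unfolding \<pi>_def by (subst wfrec[OF wf_memrel]) (auto simp: cut_def memrel_def intro!: arg_cong[where f=vset])
  have epi: "elts (\<pi> y) = \<pi> ` (Y \<inter> elts y)" for y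
    by (subst pi, rule elts_vset_small, rule small_image, rule small_subset[of "elts y"]) auto
  have "inj_on \<pi> Y"
  proof (rule inj_onI, rule ccontr)
    fix x y assume xy: "x \<in> Y" "y \<in> Y" "\<pi> x = \<pi> y" "x \<noteq> y"
    then have "x \<in> elts y \<or> y \<in> elts x" using Ord_linear assms by blast
    then have "\<pi> x \<in> elts (\<pi> y) \<or> \<pi> y \<in> elts (\<pi> x)" using xy(1,2) unfolding epi by blast
    then show False using xy mem_not_refl by metis
  qed
  moreover have "Ord (vset (\<pi> ` Y))"
  proof (rule Ord_vset[OF small_image[OF assms(2)]])
    fix x assume "x \<in> \<pi> ` Y"
    then obtain y where y: "x = \<pi> y" "y \<in> Y" by blast
    have *: "elts (\<pi> z) \<subseteq> elts (\<pi> y)" if "z \<in> elts y" for z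
      using that Ord_mem_subset[OF assms(1)[OF y(2)]] by (auto simp: epi)
    have **: "transitive_set (\<pi> z)" if "Ord z" for z
      using Ord_mem_subset[OF that] unfolding transitive_set_def by (auto simp: epi)
    have "Ord x" unfolding Ord_def y
      using ** assms(1) y(2) by (auto simp: epi)
    then show "Ord x \<and> elts x \<subseteq> \<pi> ` Y" using y by (auto simp: epi)
  qed
  ultimately show ?thesis
    by (metis elts_vset_small inj_on_image_eqpoll_self small_image[OF assms(2)])
qed

text \<open>A copy of \<open>X\<close> inside the successor collapses to an ordinal, and an ordinal
  that does not inject into \<open>\<kappa>\<close> contains the successor.\<close>

lemma eqpoll_succ_card:
  fixes \<kappa> :: "'v::zfc_universe"
  assumes \<kappa>: "Ord \<kappa>" and X: "X \<lesssim> elts (succ_card \<kappa>)" "\<not> X \<lesssim> elts \<kappa>"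
  shows "X \<approx> elts (succ_card \<kappa>)"
proof -
  obtain f where f: "inj_on f X" "f ` X \<subseteq> elts (succ_card \<kappa>)"
    using X(1) unfolding lepoll_def by blast
  have fX: "f ` X \<approx> X" by (rule inj_on_image_eqpoll_self[OF f(1)])
  obtain \<alpha> :: 'v where \<alpha>: "Ord \<alpha>" "elts \<alpha> \<approx> f ` X"
    using Ord_eqpoll_subset[OF _ small_subset[OF small_elts f(2)]] f(2) elts_succ_card[OF \<kappa>] by auto
  have aX: "elts \<alpha> \<approx> X" using \<alpha>(2) fX eqpoll_trans by blast
  then have "\<not> elts \<alpha> \<lesssim> elts \<kappa>" using X(2) eqpoll_sym lepoll_trans1 by blast
  then have "elts (succ_card \<kappa>) \<subseteq> elts \<alpha>"
    using Ord_not_mem[OF \<alpha>(1) Ord_succ_card[OF \<kappa>]] elts_succ_card[OF \<kappa>] by blast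
  then have "elts (succ_card \<kappa>) \<lesssim> X" using aX lepoll_trans2 subset_imp_lepoll by blast
  then show ?thesis using X(1) lepoll_antisym by blast
qed

section \<open>The cardinals aleph_0, aleph_1 and aleph_2\<close>

lemma elts_vnat: "elts (vnat n :: 'v::zfc_universe) = vnat ` {..<n}"
proof (induct n)
  case 0
  show ?case by (simp add: elts_vset_small small_countable)
next
  case (Suc n)
  have "small (insert (vnat n) (elts (vnat n :: 'v)))" by (intro small_insert) simp
  then show ?case
    by (simp add: elts_vset_small lessThan_Suc Suc)
qed

lemma vnat_inject: "(vnat m :: 'v::zfc_universe) = vnat n \<longleftrightarrow> m = n"
proof -
  have "(vnat m :: 'v) \<noteq> vnat n" if "m < n" for m n
    using that mem_not_refl[of "vnat n :: 'v"] by (metis elts_vnat imageI lessThan_iff)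
  then show ?thesis by (metis linorder_neqE_nat)
qed

lemma elts_aleph_0: "elts (aleph 0 :: 'v::zfc_universe) = range vnat"
  by (simp add: elts_vset_small small_countable)

lemma Ord_aleph_0: "Ord (aleph 0)"
  unfolding Ord_def transitive_set_def elts_aleph_0 by (auto simp: elts_vnat)

lemma lepoll_aleph_0: "X \<lesssim> elts (aleph 0 :: 'v::zfc_universe) \<longleftrightarrow> countable X"
proof
  show "X \<lesssim> elts (aleph 0 :: 'v) \<Longrightarrow> countable X"
    unfolding elts_aleph_0 by (rule countable_lepoll[rotated]) auto
  assume "countable X"
  then have "X \<lesssim> (UNIV :: nat set)"
    unfolding lepoll_def countable_def by blast
  also have "(UNIV :: nat set) \<lesssim> elts (aleph 0 :: 'v)"
    unfolding elts_aleph_0 lepoll_def using vnat_inject by (intro exI[of _ vnat]) (auto simp: inj_def)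
  finally show "X \<lesssim> elts (aleph 0 :: 'v)" .
qed

text \<open>A constant of its own keeps simp from rewriting \<open>aleph 1\<close> to a
  \<open>succ_card\<close>.\<close>

definition omega1 :: "'v::zfc_universe" where
  "omega1 = aleph 1"

definition omega2 :: "'v::zfc_universe" where
  "omega2 = aleph 2"

lemma omega1_eq: "omega1 = succ_card (aleph 0)"
  unfolding omega1_def by simp

lemma omega2_eq: "omega2 = succ_card omega1"
  unfolding omega2_def omega1_def numeral_2_eq_2 by simp

lemma elts_omega1: "elts omega1 = {\<alpha>. Ord \<alpha> \<and> countable (elts \<alpha>)}"
  unfolding omega1_eq elts_succ_card[OF Ord_aleph_0] lepoll_aleph_0 ..

lemma Ord_omega1: "Ord omega1"
  unfolding omega1_eq by (rule Ord_succ_card[OF Ord_aleph_0])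

lemma cardinal_omega1: "cardinal omega1"
  unfolding omega1_eq by (rule cardinal_succ_card[OF Ord_aleph_0])

lemma uncountable_omega1: "uncountable (elts (omega1 :: 'v::zfc_universe))"
  using succ_card_not_lepoll[OF Ord_aleph_0] unfolding omega1_eq lepoll_aleph_0 .

lemma omega2_not_lepoll: "\<not> elts (omega2 :: 'v::zfc_universe) \<lesssim> elts (omega1 :: 'v)"
  unfolding omega2_eq by (rule succ_card_not_lepoll[OF Ord_omega1])

lemma eqpoll_omega2:
  "X \<lesssim> elts (omega2 :: 'v::zfc_universe) \<Longrightarrow> \<not> X \<lesssim> elts (omega1 :: 'v) \<Longrightarrow> X \<approx> elts (omega2 :: 'v)"
  unfolding omega2_eq by (rule eqpoll_succ_card[OF Ord_omega1])

text \<open>Regularity of omega_1. Throwing in each \<open>f n\<close> besides its elements makes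
  the bound strict.\<close>

lemma omega1_bounded:
  fixes f :: "nat \<Rightarrow> 'v::zfc_universe"
  assumes "\<And>n. f n \<in> elts omega1"
  shows "\<exists>\<delta>\<in>elts omega1. \<forall>n. f n \<in> elts \<delta>"
proof -
  define X where "X = (\<Union>n. insert (f n) (elts (f n)))"
  have f: "Ord (f n)" "countable (elts (f n))" for n
    using assms by (auto simp: elts_omega1)
  have cX: "countable X" unfolding X_def using f(2) by auto
  have "Ord (vset X)"
  proof (rule Ord_vset[OF small_countable[OF cX]])
    fix x assume "x \<in> X"
    then obtain n where n: "x = f n \<or> x \<in> elts (f n)" unfolding X_def by blast
    then have "Ord x" "elts x \<subseteq> elts (f n)" using f(1) Ord_mem Ord_mem_subset by blast+
    then show "Ord x \<and> elts x \<subseteq> X" unfolding X_def by blast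
  qed
  then have "vset X \<in> elts omega1"
    by (simp add: elts_omega1 elts_vset_small[OF small_countable] cX)
  then show ?thesis using elts_vset_small[OF small_countable[OF cX]] by (auto simp: X_def)
qed

text \<open>This description, unlike the definition through \<open>succ_card\<close>, can be read
  inside \<open>H\<close>.\<close>

lemma omega1_unique:
  assumes "Ord x" "\<And>y. y \<in> elts x \<Longrightarrow> countable (elts y)" "uncountable (elts x)"
  shows "x = omega1"
proof -
  have "x \<notin> elts omega1" using assms(3) by (simp add: elts_omega1)
  moreover have "omega1 \<notin> elts x" using assms(2) uncountable_omega1 by metis
  ultimately show ?thesis using Ord_linear[OF assms(1) Ord_omega1] by simp
qed


subsection \<open>An unfolded open game\<close>

text \<open>
  A strategy of the discarding player, as a well-founded tree, so that it wins after finitely many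
  moves; this replaces ordinal ranks of positions. \<open>Void\<close> only serves to make the datatype non-empty.
\<close>

datatype 's refutation = Void | Refutation (excluded: "'s set") (continue: "'s \<Rightarrow> 's refutation")

text \<open>\<open>I\<close> is the ideal of sets that may be discarded. The strategy has won as
  soon as the discarded moves include every \<open>ok\<close> one.\<close>

primrec refutes ::
  "('s \<Rightarrow> 's set) \<Rightarrow> ('s \<Rightarrow> bool) \<Rightarrow> ('s set \<Rightarrow> bool) \<Rightarrow> 's refutation \<Rightarrow> 's \<Rightarrow> bool" where
  "refutes K ok I Void s \<longleftrightarrow> False"
| "refutes K ok I (Refutation B f) s \<longleftrightarrow>
     I B \<and> (\<forall>s'\<in>K s - B. ok s' \<longrightarrow> refutes K ok I (f s') s')"

text \<open>The order of choices is the point: \<open>bounded\<close> yields \<open>d\<close> only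
  after a whole run is known, while a refutation depends on \<open>d\<close>. Closure of
  \<open>I\<close> under unions indexed by \<open>D\<close> permits a run against all refutations
  before \<open>d\<close> is chosen.\<close>

lemma game_lemma:
  fixes K :: "'s \<Rightarrow> 's set" and I :: "'s set \<Rightarrow> bool" and ok :: "'d \<Rightarrow> 's \<Rightarrow> bool"
  assumes K_large: "\<And>s. s \<in> S \<Longrightarrow> \<not> I (K s)" and K_S: "\<And>s. s \<in> S \<Longrightarrow> K s \<subseteq> S"
    and I_UN: "\<And>F. (\<And>d. d \<in> D \<Longrightarrow> I (F d)) \<Longrightarrow> I (\<Union>d\<in>D. F d)"
    and I_subset: "\<And>A B. I B \<Longrightarrow> A \<subseteq> B \<Longrightarrow> I A"
    and I_empty: "I {}"
    and bounded: "\<And>t :: nat \<Rightarrow> 's. range t \<subseteq> S \<Longrightarrow> \<exists>d\<in>D. \<forall>n. ok d (t n)"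
    and s0: "s0 \<in> S"
  shows "\<exists>d\<in>D. \<exists>W\<subseteq>S. s0 \<in> W \<and> (\<forall>s\<in>W. \<not> I {s'\<in>K s. ok d s' \<and> s' \<in> W})"
proof (rule ccontr)
  assume neg: "\<not> ?thesis"
  have "\<exists>w. refutes K (ok d) I w s0" if d: "d \<in> D" for d
  proof (rule ccontr)
    assume no: "\<not> ?thesis"
    \<comment> \<open>Were the \<open>ok\<close> successors in \<open>W\<close> negligible,
      discarding them and following refutations of the others would refute \<open>s\<close>.\<close>
    define W where "W = {s\<in>S. \<not> (\<exists>w. refutes K (ok d) I w s)}"
    have "\<not> I {s'\<in>K s. ok d s' \<and> s' \<in> W}" if s: "s \<in> W" for s
    proof
      define B where "B = {s'\<in>K s. ok d s' \<and> s' \<in> W}"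
      assume "I {s'\<in>K s. ok d s' \<and> s' \<in> W}"
      then have "I B" by (simp add: B_def)
      define f where "f s' = (SOME w. refutes K (ok d) I w s')" for s'
      have "refutes K (ok d) I (f s') s'" if "s' \<in> K s - B" "ok d s'" for s'
      proof -
        have "s' \<in> S" using K_S s that unfolding W_def by blast
        then have "\<exists>w. refutes K (ok d) I w s'" using that unfolding B_def W_def by blast
        then show ?thesis unfolding f_def by (rule someI_ex)
      qed
      then have "refutes K (ok d) I (Refutation B f) s" using \<open>I B\<close> by simp
      then show False using s unfolding W_def by blast
    qed
    moreover have "W \<subseteq> S" "s0 \<in> W" using no s0 unfolding W_def by auto
    ultimately show False using neg d by blast
  qed
  then obtain w0 where w0: "\<And>d. d \<in> D \<Longrightarrow> refutes K (ok d) I (w0 d) s0" by metis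
  \<comment> \<open>One run that avoids what all the refutations discard, so that it follows each of them for as
    long as it stays inside the corresponding \<open>ok d\<close>.\<close>
  define X where "X s w =
    (\<Union>d\<in>D. if refutes K (ok d) I (w d) s then excluded (w d) else {})" for s w
  define move where "move s w = (SOME s'. s' \<in> K s - X s w)" for s w
  \<comment> \<open>Next to the position, the state keeps one current strategy for every
    \<open>d\<close>.\<close>
  define st where "st = rec_nat (s0, w0) (\<lambda>_ (s, w). (move s w, \<lambda>d. continue (w d) (move s w)))"
  define s where "s n = fst (st n)" for n
  define w where "w n = snd (st n)" for n
  have st: "s 0 = s0" "w 0 = w0" "s (Suc n) = move (s n) (w n)"
    "w (Suc n) d = continue (w n d) (s (Suc n))" for n d
    by (simp_all add: s_def w_def st_def split_beta)
  have exc: "I (excluded v)" if "refutes K (ok d) I v t" for d v t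
    using that by (cases v) simp_all
  have IX: "I (X t v)" for t v
    unfolding X_def by (rule I_UN) (use exc I_empty in auto)
  have move: "move t v \<in> K t - X t v" if "t \<in> S" for t v
  proof -
    have "\<not> K t \<subseteq> X t v" using I_subset[OF IX] K_large[OF that] by blast
    then have "\<exists>s'. s' \<in> K t - X t v" by blast
    then show ?thesis unfolding move_def by (rule someI_ex)
  qed
  have sS: "s n \<in> S" for n
  proof (induct n)
    case 0
    show ?case using s0 st(1) by simp
  next
    case (Suc n)
    then show ?case using move[OF Suc, of "w n"] K_S[OF Suc] st(3)[of n] by auto
  qed
  then obtain d where d: "d \<in> D" "\<And>n. ok d (s n)" using bounded[of s] by blast
  have ref: "refutes K (ok d) I (w n d) (s n)" for n
  proof (induct n)
    case 0
    show ?case using w0[OF d(1)] st by simp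
  next
    case (Suc n)
    have m: "s (Suc n) \<in> K (s n) - X (s n) (w n)" using move[OF sS] st(3) by metis
    then have "s (Suc n) \<notin> excluded (w n d)" using Suc d(1) unfolding X_def by auto
    then show ?case using Suc m d(2)[of "Suc n"] st(4)[of n d] by (cases "w n d") auto
  qed
  \<comment> \<open>The run would trace an infinite branch through the strategy for this
    \<open>d\<close>; induction over the datatype rules that out.\<close>
  have "w n d \<noteq> v" for n v
  proof (induct v arbitrary: n)
    case Void
    show ?case using ref[of n] by auto
  next
    case (Refutation B f)
    show ?case
    proof
      assume "w n d = Refutation B f"
      then have "w (Suc n) d = f (s (Suc n))" using st(4)[of n d] by simp
      then show False using Refutation by blast
    qed
  qed
  then show False by blast
qed


subsection \<open>Trees with large splitting\<close>

text \<open>Nodes under end extension, with an ideal whose positive sets stand for those of size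
  aleph_2. \<open>le_linear\<close> says that initial segments of a node are ordered by
  length.\<close>

locale large_tree =
  fixes S :: "'n set" and le :: "'n \<Rightarrow> 'n \<Rightarrow> bool" (infix "\<sqsubseteq>" 50)
    and len :: "'n \<Rightarrow> nat" and I :: "'n set \<Rightarrow> bool"
  assumes le_refl: "x \<sqsubseteq> x"
    and le_trans: "x \<sqsubseteq> y \<Longrightarrow> y \<sqsubseteq> z \<Longrightarrow> x \<sqsubseteq> z"
    and le_antisym: "x \<sqsubseteq> y \<Longrightarrow> y \<sqsubseteq> x \<Longrightarrow> x = y"
    and le_linear: "\<lbrakk>x \<in> S; y \<in> S; z \<in> S; x \<sqsubseteq> z; y \<sqsubseteq> z; len x \<le> len y\<rbrakk> \<Longrightarrow> x \<sqsubseteq> y"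
    and I_subset: "I B \<Longrightarrow> A \<subseteq> B \<Longrightarrow> I A"
    and I_UN_nat: "(\<And>n. I (F n)) \<Longrightarrow> I (\<Union>n::nat. F n)"
    and I_singleton: "I {x}"
begin

definition tree :: "'n set \<Rightarrow> bool" where
  "tree T \<longleftrightarrow> T \<noteq> {} \<and> T \<subseteq> S \<and> (\<forall>\<eta>\<in>T. \<forall>\<tau>\<in>S. \<tau> \<sqsubseteq> \<eta> \<longrightarrow> \<tau> \<in> T) \<and> (\<forall>\<eta>\<in>T. \<not> I {\<tau>\<in>T. \<eta> \<sqsubseteq> \<tau>})"

definition cone :: "'n set \<Rightarrow> 'n \<Rightarrow> 'n set" where
  "cone T \<nu> = {x\<in>T. x \<sqsubseteq> \<nu> \<or> \<nu> \<sqsubseteq> x}"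

lemma tree_S: "tree T \<Longrightarrow> x \<in> T \<Longrightarrow> x \<in> S"
  unfolding tree_def by blast

lemma tree_down: "tree T \<Longrightarrow> x \<in> T \<Longrightarrow> y \<in> S \<Longrightarrow> y \<sqsubseteq> x \<Longrightarrow> y \<in> T"
  unfolding tree_def by blast

lemma len_eq: "x \<in> S \<Longrightarrow> y \<in> S \<Longrightarrow> x \<sqsubseteq> y \<Longrightarrow> len y \<le> len x \<Longrightarrow> x = y"
  using le_linear[of y x y] le_refl le_antisym by blast

lemma len_mono: "x \<in> S \<Longrightarrow> y \<in> S \<Longrightarrow> x \<sqsubseteq> y \<Longrightarrow> len x \<le> len y"
  using len_eq by fastforce

lemma tree_cone:
  assumes "tree T" "\<nu> \<in> T"
  shows "tree (cone T \<nu>)"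
  unfolding tree_def
proof (intro conjI ballI impI)
  show "cone T \<nu> \<noteq> {}" using assms le_refl unfolding cone_def by blast
  show "cone T \<nu> \<subseteq> S" using assms tree_S unfolding cone_def by blast
next
  fix \<eta> \<tau> assume h: "\<eta> \<in> cone T \<nu>" "\<tau> \<in> S" "\<tau> \<sqsubseteq> \<eta>"
  then have \<eta>: "\<eta> \<in> T" unfolding cone_def by blast
  note * = \<eta> tree_S[OF assms(1) \<eta>] tree_S[OF assms] tree_down[OF assms(1) \<eta> h(2,3)]
  have "\<tau> \<sqsubseteq> \<nu> \<or> \<nu> \<sqsubseteq> \<tau>"
  proof (cases "\<eta> \<sqsubseteq> \<nu>")
    case True
    then show ?thesis using h le_trans by blast
  next
    case False
    then have "\<nu> \<sqsubseteq> \<eta>" using h unfolding cone_def by blast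
    then show ?thesis using le_linear[of \<tau> \<nu> \<eta>] le_linear[of \<nu> \<tau> \<eta>] h * by linarith
  qed
  then show "\<tau> \<in> cone T \<nu>" using * unfolding cone_def by blast
next
  fix \<eta> assume h: "\<eta> \<in> cone T \<nu>"
  \<comment> \<open>If \<open>\<eta>\<close> is properly below \<open>\<nu>\<close>, largeness comes
    from the part of \<open>T\<close> above \<open>\<nu>\<close>, all of which lies in the
    cone.\<close>
  then have "{\<tau>\<in>T. (if \<nu> \<sqsubseteq> \<eta> then \<eta> else \<nu>) \<sqsubseteq> \<tau>} \<subseteq> {\<tau> \<in> cone T \<nu>. \<eta> \<sqsubseteq> \<tau>}"
    using le_trans unfolding cone_def by auto
  moreover have "\<not> I {\<tau>\<in>T. (if \<nu> \<sqsubseteq> \<eta> then \<eta> else \<nu>) \<sqsubseteq> \<tau>}"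
    using assms h unfolding tree_def cone_def by auto
  ultimately show "\<not> I {\<tau> \<in> cone T \<nu>. \<eta> \<sqsubseteq> \<tau>}" using I_subset by blast
qed

text \<open>Namba conditions ask for aleph_2 extensions of a node at any distance, not for immediate
  successors. These are spread over countably many levels, so one level has positively many, and
  distinct nodes of one level are incomparable.\<close>

lemma tree_split:
  assumes "tree T" "\<nu> \<in> T"
  shows "\<exists>m. len \<nu> < m \<and> \<not> I {\<tau>\<in>T. \<nu> \<sqsubseteq> \<tau> \<and> len \<tau> = m}"
proof (rule ccontr)
  assume "\<not> ?thesis"
  then have *: "I {\<tau>\<in>T. \<nu> \<sqsubseteq> \<tau> \<and> len \<tau> = m}" if "len \<nu> < m" for m using that by blast
  have "I {\<tau>\<in>T. \<nu> \<sqsubseteq> \<tau> \<and> len \<tau> = m}" for m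
  proof (cases "len \<nu> < m")
    case True
    then show ?thesis by (rule *)
  next
    case False
    then have "{\<tau>\<in>T. \<nu> \<sqsubseteq> \<tau> \<and> len \<tau> = m} \<subseteq> {\<nu>}"
      using len_eq[of \<nu>] tree_S[OF assms(1)] assms(2) by force
    then show ?thesis using I_subset I_singleton by blast
  qed
  then have "I (\<Union>m. {\<tau>\<in>T. \<nu> \<sqsubseteq> \<tau> \<and> len \<tau> = m})" by (rule I_UN_nat)
  moreover have "(\<Union>m. {\<tau>\<in>T. \<nu> \<sqsubseteq> \<tau> \<and> len \<tau> = m}) = {\<tau>\<in>T. \<nu> \<sqsubseteq> \<tau>}" by blast
  ultimately show False using assms unfolding tree_def by auto
qed

lemma tree_long:
  assumes "tree T" "\<nu> \<in> T"
  shows "\<exists>\<tau>\<in>T. \<nu> \<sqsubseteq> \<tau> \<and> n \<le> len \<tau>"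
proof (induct n)
  case 0
  show ?case using assms le_refl by blast
next
  case (Suc n)
  then obtain \<tau> where \<tau>: "\<tau> \<in> T" "\<nu> \<sqsubseteq> \<tau>" "n \<le> len \<tau>" by blast
  obtain m where m: "len \<tau> < m" "\<not> I {\<sigma>\<in>T. \<tau> \<sqsubseteq> \<sigma> \<and> len \<sigma> = m}"
    using tree_split[OF assms(1) \<tau>(1)] by blast
  have "I {}" by (rule I_subset[OF I_singleton]) blast
  then have "{\<sigma>\<in>T. \<tau> \<sqsubseteq> \<sigma> \<and> len \<sigma> = m} \<noteq> {}" using m(2) by metis
  then obtain \<sigma> where "\<sigma> \<in> T" "\<tau> \<sqsubseteq> \<sigma>" "len \<sigma> = m" by blast
  then show ?case using \<tau> m le_trans[OF \<tau>(2)] by (intro bexI[of _ \<sigma>]) auto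
qed

text \<open>The subtree has nodes longer than \<open>\<nu>\<close>, which must lie above it. So
  passing to a deciding subtree of a cone never loses the node.\<close>

lemma mem_of_subset_cone:
  assumes "tree T" "\<nu> \<in> T" "tree T'" "T' \<subseteq> cone T \<nu>"
  shows "\<nu> \<in> T'"
proof -
  obtain x where "x \<in> T'" using assms unfolding tree_def by blast
  then obtain y where y: "y \<in> T'" "Suc (len \<nu>) \<le> len y" using tree_long[OF assms(3)] by blast
  have S: "\<nu> \<in> S" "y \<in> S" using y assms tree_S by blast+
  then have "\<not> y \<sqsubseteq> \<nu>" using len_mono y(2) by fastforce
  then have "\<nu> \<sqsubseteq> y" using y(1) assms(4) unfolding cone_def by blast
  then show ?thesis using tree_down assms(3) y(1) S by blast
qed

text \<open>\<open>dec n T \<beta>\<close> stands for: \<open>T\<close> decides the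
  \<open>n\<close>-th name to be \<open>\<beta>\<close>. The resulting tree need not decide
  anything, since values depend on the branch; instead every subtree of it meets a deciding tree
  with value below \<open>\<delta>\<close> in a tree.\<close>

theorem fusion:
  fixes dec :: "nat \<Rightarrow> 'n set \<Rightarrow> 'd \<Rightarrow> bool" and lt :: "'d \<Rightarrow> 'd \<Rightarrow> bool"
  assumes dec: "\<And>n T. tree T \<Longrightarrow> \<exists>T'\<subseteq>T. tree T' \<and> (\<exists>\<beta>\<in>D. dec n T' \<beta>)"
    and bounded: "\<And>f :: nat \<Rightarrow> 'd. range f \<subseteq> D \<Longrightarrow> \<exists>\<delta>\<in>D. \<forall>n. lt (f n) \<delta>"
    and I_UN: "\<And>F. (\<And>d. d \<in> D \<Longrightarrow> I (F d)) \<Longrightarrow> I (\<Union>d\<in>D. F d)"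
    and T0: "tree T0"
  shows "\<exists>\<delta>\<in>D. \<exists>T\<subseteq>T0. tree T \<and> (\<forall>n r. r \<subseteq> T \<and> tree r \<longrightarrow>
           (\<exists>r' T' \<beta>. r' \<subseteq> r \<and> tree r' \<and> r' \<subseteq> T' \<and> tree T' \<and> \<beta> \<in> D \<and> dec n T' \<beta> \<and> lt \<beta> \<delta>))"
proof -
  have "\<exists>m. \<forall>p \<nu>. tree p \<and> \<nu> \<in> p \<longrightarrow> len \<nu> < m p \<nu> \<and> \<not> I {\<tau>\<in>p. \<nu> \<sqsubseteq> \<tau> \<and> len \<tau> = m p \<nu>}"
    using tree_split by (intro choice allI) blast
  then obtain m where m: "\<And>p \<nu>. tree p \<Longrightarrow> \<nu> \<in> p \<Longrightarrow>
      len \<nu> < m p \<nu> \<and> \<not> I {\<tau>\<in>p. \<nu> \<sqsubseteq> \<tau> \<and> len \<tau> = m p \<nu>}"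
    by blast
  \<comment> \<open>The implication inside the existential makes the choice total over all triples.
    \<open>P\<close> and \<open>B\<close> below are the chosen deciding subtree and its
    value.\<close>
  have "\<exists>g. tree p \<and> \<tau> \<in> p \<longrightarrow>
      tree (fst g) \<and> fst g \<subseteq> cone p \<tau> \<and> \<tau> \<in> fst g \<and> snd g \<in> D \<and> dec k (fst g) (snd g)" for k p \<tau>
    using dec[of "cone p \<tau>" k] tree_cone[of p \<tau>] mem_of_subset_cone[of p \<tau>]
    unfolding split_paired_Ex fst_conv snd_conv by meson
  then have "\<exists>G. \<forall>z. tree (fst (snd z)) \<and> snd (snd z) \<in> fst (snd z) \<longrightarrow>
      tree (fst (G z)) \<and> fst (G z) \<subseteq> cone (fst (snd z)) (snd (snd z)) \<and> snd (snd z) \<in> fst (G z) \<and>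
      snd (G z) \<in> D \<and> dec (fst z) (fst (G z)) (snd (G z))"
    by (intro choice allI)
  then obtain G where G: "\<forall>z. tree (fst (snd z)) \<and> snd (snd z) \<in> fst (snd z) \<longrightarrow>
      tree (fst (G z)) \<and> fst (G z) \<subseteq> cone (fst (snd z)) (snd (snd z)) \<and> snd (snd z) \<in> fst (G z) \<and>
      snd (G z) \<in> D \<and> dec (fst z) (fst (G z)) (snd (G z))" by blast
  define P B where "P k p \<tau> = fst (G (k, p, \<tau>))" and "B k p \<tau> = snd (G (k, p, \<tau>))" for k p \<tau>
  have PB: "tree (P k p \<tau>) \<and> P k p \<tau> \<subseteq> cone p \<tau> \<and> \<tau> \<in> P k p \<tau> \<and>
      B k p \<tau> \<in> D \<and> dec k (P k p \<tau>) (B k p \<tau>)" if "tree p" "\<tau> \<in> p" for k p \<tau>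
    using G[rule_format, of "(k, p, \<tau>)"] that by (simp add: P_def B_def)
  \<comment> \<open>A position: the number of moves made, the current node, the subtree still
    allowed, and the value decided by the last move.\<close>
  define idx node sub val where "idx s = fst s" and "node s = fst (snd s)"
    and "sub s = fst (snd (snd s))" and "val s = snd (snd (snd s))"
    for s :: "nat \<times> 'n \<times> 'n set \<times> 'd"
  note sel = idx_def node_def sub_def val_def
  define St where "St = {s. tree (sub s) \<and> node s \<in> sub s \<and> val s \<in> D}"
  define K where "K s = (\<lambda>\<tau>. (Suc (idx s), \<tau>, P (idx s) (sub s) \<tau>, B (idx s) (sub s) \<tau>)) `
      {\<tau>\<in>sub s. node s \<sqsubseteq> \<tau> \<and> len \<tau> = m (sub s) (node s)}" for s
  have nodeK: "node ` K s = {\<tau>\<in>sub s. node s \<sqsubseteq> \<tau> \<and> len \<tau> = m (sub s) (node s)}" for s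
    by (force simp: K_def sel)
  have K: "idx t = Suc (idx s)" "node t \<in> sub s" "node s \<sqsubseteq> node t"
      "len (node t) = m (sub s) (node s)" "t \<in> St" "sub t \<subseteq> sub s"
      "dec (idx s) (sub t) (val t)"
    if "s \<in> St" "t \<in> K s" for s t
  proof -
    obtain \<tau> where \<tau>: "\<tau> \<in> sub s" "node s \<sqsubseteq> \<tau>" "len \<tau> = m (sub s) (node s)"
      "t = (Suc (idx s), \<tau>, P (idx s) (sub s) \<tau>, B (idx s) (sub s) \<tau>)"
      using \<open>t \<in> K s\<close> unfolding K_def by auto
    have "tree (sub s)" using \<open>s \<in> St\<close> unfolding St_def by blast
    note PB = PB[OF this \<tau>(1), of "idx s"]
    have e: "idx t = Suc (idx s)" "node t = \<tau>" "sub t = P (idx s) (sub s) \<tau>"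
      "val t = B (idx s) (sub s) \<tau>"
      unfolding sel \<tau>(4) by simp_all
    show "idx t = Suc (idx s)" "node t \<in> sub s" "node s \<sqsubseteq> node t"
      "len (node t) = m (sub s) (node s)" "t \<in> St" "sub t \<subseteq> sub s"
      "dec (idx s) (sub t) (val t)"
      using PB \<tau>(1-3) unfolding e St_def cone_def by (auto simp: e)
  qed
  have K_inj: "t = u" if "t \<in> K s" "u \<in> K s" "node t = node u" for s t u
    using that unfolding K_def by (auto simp: sel)
  obtain \<nu>0 where \<nu>0: "\<nu>0 \<in> T0" using T0 unfolding tree_def by blast
  obtain \<beta>0 where \<beta>0: "\<beta>0 \<in> D" using dec[OF T0] by blast
  \<comment> \<open>Nothing has been decided yet, so an arbitrary element of \<open>D\<close> fills
    the value.\<close>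
  define s0 where "s0 = (0::nat, \<nu>0, T0, \<beta>0)"
  have e0: "idx s0 = 0" "node s0 = \<nu>0" "sub s0 = T0" by (simp_all add: s0_def sel)
  have s0: "s0 \<in> St" using T0 \<nu>0 \<beta>0 by (simp add: St_def s0_def sel)
  have "\<exists>\<delta>\<in>D. \<exists>W\<subseteq>St. s0 \<in> W \<and> (\<forall>s\<in>W. \<not> I (node ` {s'\<in>K s. lt (val s') \<delta> \<and> s' \<in> W}))"
  \<comment> \<open>The ideal lives on nodes. Measuring positions by their nodes is faithful, since
    a node determines the move from a fixed position (\<open>K_inj\<close>).\<close>
  proof (rule game_lemma[where I = "\<lambda>A. I (node ` A)" and ok = "\<lambda>\<delta> s. lt (val s) \<delta>"])
    show "s0 \<in> St" by (rule s0)
    show "K s \<subseteq> St" if "s \<in> St" for s using K(5)[OF that] by blast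
    show "\<not> I (node ` K s)" if "s \<in> St" for s
      unfolding nodeK using m that unfolding St_def by blast
    show "I (node ` (\<Union>d\<in>D. F d))" if "\<And>d. d \<in> D \<Longrightarrow> I (node ` F d)" for F :: "'d \<Rightarrow> _"
      unfolding image_UN using that by (rule I_UN)
    show "I (node ` A)" if "I (node ` B)" "A \<subseteq> B" for A B
      by (rule I_subset[OF that(1)]) (use that(2) in blast)
    show "I (node ` {})" by (rule I_subset[OF I_singleton]) simp
    show "\<exists>d\<in>D. \<forall>n. lt (val (t n)) d" if "range t \<subseteq> St" for t :: "nat \<Rightarrow> _"
      using bounded[of "\<lambda>n. val (t n)"] that unfolding St_def by blast
  qed
  then obtain \<delta> W where \<delta>: "\<delta> \<in> D" and W: "W \<subseteq> St" "s0 \<in> W"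
    "\<And>s. s \<in> W \<Longrightarrow> \<not> I (node ` {s'\<in>K s. lt (val s') \<delta> \<and> s' \<in> W})" by blast
  \<comment> \<open>\<open>W\<close> may contain positions with unrelated histories. Only those
    reached from \<open>s0\<close> inside \<open>W\<close> are kept, so that plays towards a common
    node agree stage by stage (\<open>uniq\<close>).\<close>
  define R where "R = {(s, t). s \<in> W \<and> t \<in> K s \<and> lt (val t) \<delta> \<and> t \<in> W}"
  define reach where "reach = {s. (s0, s) \<in> R\<^sup>*}"
  have reach_W: "s \<in> W" if "s \<in> reach" for s
    using that unfolding reach_def mem_Collect_eq by (induct rule: rtrancl_induct) (auto simp: R_def W)
  have reach_step: "t \<in> reach" if "s \<in> reach" "(s, t) \<in> R" for s t
    using that unfolding reach_def by (auto intro: rtrancl_into_rtrancl)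
  have reach_S: "node s \<in> S" if "s \<in> reach" for s
    using reach_W[OF that] W(1) tree_S unfolding St_def by blast
  have reach_cases: "s = s0 \<or> (\<exists>u\<in>reach. (u, s) \<in> R \<and> idx s = Suc (idx u) \<and> node u \<sqsubseteq> node s)"
    if "s \<in> reach" for s
  proof -
    have "(s0, s) \<in> R\<^sup>*" using that by (simp add: reach_def)
    then show ?thesis
    proof (cases rule: rtranclE)
      case (step u)
      then have u: "u \<in> reach" by (simp add: reach_def)
      have "u \<in> St" "s \<in> K u" using reach_W[OF u] W(1) step(2) by (auto simp: R_def)
      then show ?thesis using K(1,3) u step(2) by blast
    qed simp
  qed
  have mono: "\<exists>t\<in>reach. idx t = j \<and> node t \<sqsubseteq> node s \<and> sub s \<subseteq> sub t"
    if "s \<in> reach" "j \<le> idx s" for s j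
  proof -
    have "(s0, s) \<in> R\<^sup>*" using that by (simp add: reach_def)
    then show ?thesis using that(2)
    proof (induct arbitrary: j rule: rtrancl_induct)
      case base
      then show ?case using e0 le_refl by (intro bexI[of _ s0]) (auto simp: reach_def)
    next
      case (step u t)
      have u: "u \<in> reach" using step(1) by (simp add: reach_def)
      then have t: "t \<in> reach" using step(2) reach_step by blast
      have "u \<in> St" "t \<in> K u" using reach_W[OF u] W(1) step(2) by (auto simp: R_def)
      note Kt = K[OF this]
      show ?case
      proof (cases "j = idx t")
        case True
        then show ?thesis using t le_refl by blast
      next
        case False
        then have "j \<le> idx u" using step(4) Kt(1) by simp
        then show ?thesis using step(3)[of j] Kt le_trans by blast
      qed
    qed
  qed
  \<comment> \<open>By induction both positions have the same predecessor, so their nodes have the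
    same length; being below \<open>x\<close>, they agree.\<close>
  have uniq: "s = t"
    if "s \<in> reach" "t \<in> reach" "idx s = idx t" "x \<in> S" "node s \<sqsubseteq> x" "node t \<sqsubseteq> x" for s t x
    using that
  proof (induct "idx s" arbitrary: s t)
    case 0
    then show ?case using reach_cases[of s] reach_cases[of t] by auto
  next
    case (Suc n)
    obtain u where u: "u \<in> reach" "(u, s) \<in> R" "idx s = Suc (idx u)" "node u \<sqsubseteq> node s"
      using reach_cases[OF Suc(3)] Suc(2) e0(1) by auto
    obtain v where v: "v \<in> reach" "(v, t) \<in> R" "idx t = Suc (idx v)" "node v \<sqsubseteq> node t"
      using reach_cases[OF Suc(4)] Suc(2,5) e0(1) by auto
    have "u = v"
      by (rule Suc(1)) (use u v Suc le_trans in auto)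
    moreover have "u \<in> St" using reach_W[OF u(1)] W(1) by blast
    moreover have "s \<in> K u" "t \<in> K v" using u v by (auto simp: R_def)
    ultimately have "len (node s) = len (node t)" using K(4) by metis
    then have "node s = node t"
      using le_antisym le_linear[of "node s" "node t" x] le_linear[of "node t" "node s" x]
        reach_S Suc by simp
    then show ?case using K_inj \<open>u = v\<close> \<open>s \<in> K u\<close> \<open>t \<in> K v\<close> by blast
  qed
  define T where "T = {x\<in>S. \<exists>s\<in>reach. x \<sqsubseteq> node s}"
  have "s0 \<in> reach" by (simp add: reach_def)
  have nodeT: "node s \<in> T" if "s \<in> reach" for s
    using that reach_S le_refl unfolding T_def by blast
  have reach_sub: "tree (sub s)" "node s \<in> sub s" if "s \<in> reach" for s
    using reach_W[OF that] W(1) unfolding St_def by blast+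
  have treeT: "tree T"
    unfolding tree_def
  proof (intro conjI ballI impI)
    show "T \<noteq> {}" using nodeT \<open>s0 \<in> reach\<close> by blast
    show "T \<subseteq> S" unfolding T_def by blast
    show "\<tau> \<in> T" if "\<eta> \<in> T" "\<tau> \<in> S" "\<tau> \<sqsubseteq> \<eta>" for \<eta> \<tau>
      using that le_trans unfolding T_def by blast
    fix \<eta> assume "\<eta> \<in> T"
    then obtain s where s: "s \<in> reach" "\<eta> \<sqsubseteq> node s" unfolding T_def by blast
    have sW: "s \<in> W" using reach_W[OF s(1)] .
    have "node ` {s'\<in>K s. lt (val s') \<delta> \<and> s' \<in> W} \<subseteq> {\<tau>\<in>T. \<eta> \<sqsubseteq> \<tau>}"
    proof safe
      fix t assume t: "t \<in> K s" "lt (val t) \<delta>" "t \<in> W"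
      then have "t \<in> reach" using reach_step[OF s(1)] sW unfolding R_def by blast
      then show "node t \<in> T" by (rule nodeT)
      show "\<eta> \<sqsubseteq> node t" using K(3)[of s t] t sW W(1) s(2) le_trans by blast
    qed
    then show "\<not> I {\<tau>\<in>T. \<eta> \<sqsubseteq> \<tau>}" using W(3)[OF sW] I_subset by blast
  qed
  have TT0: "T \<subseteq> T0"
  proof
    fix x assume "x \<in> T"
    then obtain s where s: "x \<in> S" "s \<in> reach" "x \<sqsubseteq> node s" unfolding T_def by blast
    obtain t where t: "t \<in> reach" "idx t = 0" "sub s \<subseteq> sub t" using mono[OF s(2), of 0] by auto
    then have "t = s0" using reach_cases[of t] by auto
    then have "node s \<in> T0" using t(3) e0 reach_sub[OF s(2)] by auto
    then show "x \<in> T0" using T0 tree_down s by blast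
  qed
  have main: "\<exists>r' T' \<beta>. r' \<subseteq> r \<and> tree r' \<and> r' \<subseteq> T' \<and> tree T' \<and> \<beta> \<in> D \<and> dec n T' \<beta> \<and> lt \<beta> \<delta>"
    if r: "r \<subseteq> T" "tree r" for n r
  proof -
    \<comment> \<open>Every subtree of \<open>T\<close> meets each stage: a node of \<open>r\<close>
      beyond the splitting level after stage \<open>k\<close> has passed the node of a position of
      stage \<open>Suc k\<close>, which is in \<open>r\<close> by downward closure.\<close>
    have ex: "\<exists>s\<in>reach. idx s = k \<and> node s \<in> r" for k
    proof (induct k)
      case 0
      obtain y where "y \<in> r" using r(2) unfolding tree_def by blast
      then obtain x where x: "x \<in> r" "len \<nu>0 \<le> len x" using tree_long[OF r(2)] by blast
      then obtain s where s: "x \<in> S" "s \<in> reach" "x \<sqsubseteq> node s" using r(1) unfolding T_def by blast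
      obtain t where t: "t \<in> reach" "idx t = 0" "node t \<sqsubseteq> node s" using mono[OF s(2), of 0] by auto
      then have "t = s0" using reach_cases[of t] by auto
      then have "\<nu>0 \<sqsubseteq> x" using le_linear[of \<nu>0 x "node s"] t x s e0
          reach_S[OF \<open>s0 \<in> reach\<close>] reach_S[OF s(2)] by simp
      then have "\<nu>0 \<in> r" using tree_down[OF r(2) x(1)] reach_S[OF \<open>s0 \<in> reach\<close>] e0 by auto
      then show ?case using e0 \<open>s0 \<in> reach\<close> by auto
    next
      case (Suc k)
      then obtain s where s: "s \<in> reach" "idx s = k" "node s \<in> r" by blast
      have sSt: "s \<in> St" using reach_W[OF s(1)] W(1) by blast
      define l where "l = m (sub s) (node s)"
      have l: "len (node s) < l" unfolding l_def using m reach_sub[OF s(1)] by blast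
      obtain x where x: "x \<in> r" "node s \<sqsubseteq> x" "l \<le> len x"
        using tree_long[OF r(2) s(3)] by blast
      then obtain t where t: "x \<in> S" "t \<in> reach" "x \<sqsubseteq> node t" using r(1) unfolding T_def by blast
      have st: "node s \<sqsubseteq> node t" using x t le_trans by blast
      \<comment> \<open>Otherwise \<open>t\<close> is \<open>s\<close> or an earlier position of its
        play, and \<open>x\<close> would be below \<open>node s\<close>, contrary to its
        length.\<close>
      have "Suc k \<le> idx t"
      proof (rule ccontr)
        assume "\<not> Suc k \<le> idx t"
        then obtain u where u: "u \<in> reach" "idx u = idx t" "node u \<sqsubseteq> node s"
          using mono[OF s(1), of "idx t"] s(2) by auto
        have "u = t" by (rule uniq[of u t "node t"]) (use u t st reach_S le_trans le_refl in auto)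
        then have "x \<sqsubseteq> node s" using u t le_trans by blast
        then show False using len_mono[of x "node s"] t(1) reach_S[OF s(1)] x(3) l by simp
      qed
      then obtain v where v: "v \<in> reach" "idx v = Suc k" "node v \<sqsubseteq> node t"
        using mono[OF t(2), of "Suc k"] by auto
      then obtain u where u: "u \<in> reach" "(u, v) \<in> R" "idx u = k" "node u \<sqsubseteq> node v"
        using reach_cases[OF v(1)] e0 by auto
      have "u = s"
        by (rule uniq[of u s "node t"]) (use u v t st s reach_S le_trans in auto)
      then have "v \<in> K s" using u(2) by (simp add: R_def)
      then have "len (node v) = l" unfolding l_def using K(4)[OF sSt] by blast
      then have "node v \<sqsubseteq> x"
        using le_linear[of "node v" x "node t"] v t x reach_S[OF v(1)] reach_S[OF t(2)] by simp
      then have "node v \<in> r" using tree_down[OF r(2) x(1)] reach_S[OF v(1)] by blast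
      then show ?case using v by blast
    qed
    \<comment> \<open>The move out of stage \<open>n\<close> decides the \<open>n\<close>-th name,
      so the value sits in a position of stage \<open>Suc n\<close>.\<close>
    obtain s where s: "s \<in> reach" "idx s = Suc n" "node s \<in> r" using ex by blast
    obtain u where u: "u \<in> reach" "(u, s) \<in> R" "idx u = n"
      using reach_cases[OF s(1)] s(2) e0 by auto
    have "u \<in> St" "s \<in> K u" "lt (val s) \<delta>" using u(2) W(1) by (auto simp: R_def)
    \<comment> \<open>Above \<open>node s\<close>, nodes of \<open>T\<close> are initial segments of
      nodes of positions reached through \<open>s\<close>, whose subtrees are contained in
      \<open>sub s\<close>.\<close>
    moreover have "cone r (node s) \<subseteq> sub s"
    proof
      fix x assume x: "x \<in> cone r (node s)"
      then have "x \<in> r" "x \<in> S" using tree_S[OF r(2)] by (auto simp: cone_def)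
      then obtain t where t: "t \<in> reach" "x \<sqsubseteq> node t" using r(1) unfolding T_def by blast
      have low: "x \<in> sub s" if "x \<sqsubseteq> node s"
        using tree_down[OF reach_sub[OF s(1)]] \<open>x \<in> S\<close> that by blast
      show "x \<in> sub s"
      proof (cases "x \<sqsubseteq> node s")
        case False
        then have sx: "node s \<sqsubseteq> x" using x by (auto simp: cone_def)
        have st: "node s \<sqsubseteq> node t" using sx t(2) le_trans by blast
        show ?thesis
        proof (cases "idx s \<le> idx t")
          case True
          then obtain v where v: "v \<in> reach" "idx v = idx s" "node v \<sqsubseteq> node t" "sub t \<subseteq> sub v"
            using mono[OF t(1)] by blast
          have "v = s" by (rule uniq[of v s "node t"]) (use v t s st reach_S in auto)
          then have "node t \<in> sub s" using reach_sub[OF t(1)] v(4) by blast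
          then show ?thesis using tree_down[OF reach_sub(1)[OF s(1)]] \<open>x \<in> S\<close> t(2) by blast
        next
          case False
          then obtain v where v: "v \<in> reach" "idx v = idx t" "node v \<sqsubseteq> node s"
            using mono[OF s(1), of "idx t"] by auto
          have "v = t"
            by (rule uniq[of v t "node t"]) (use v t st reach_S le_trans le_refl in auto)
          then show ?thesis using low v t le_trans by blast
        qed
      qed (rule low)
    qed
    moreover have "cone r (node s) \<subseteq> r" by (auto simp: cone_def)
    moreover have "tree (cone r (node s))" by (rule tree_cone[OF r(2) s(3)])
    ultimately show ?thesis
      using K(5,7)[of u s] reach_sub(1)[OF s(1)] u(3) unfolding St_def by blast
  qed
  show ?thesis
  proof (rule bexI[OF _ \<delta>], rule exI[of _ T], intro conjI allI impI)
    show "T \<subseteq> T0" by (rule TT0)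
    show "tree T" by (rule treeT)
  qed (elim conjE, rule main; assumption)
qed

end


subsection \<open>Cardinality\<close>

lemma lepoll_iff_ordLeq: "A \<lesssim> B \<longleftrightarrow> (card_of A, card_of B) \<in> ordLeq"
  unfolding lepoll_def card_of_ordLeq ..

lemma lesspoll_iff_not_lepoll: "A \<prec> B \<longleftrightarrow> \<not> B \<lesssim> A"
proof -
  have "A \<lesssim> B \<or> B \<lesssim> A"
    unfolding lepoll_iff_ordLeq by (rule ordLeq_total) (rule card_of_Well_order)+
  then show ?thesis
    unfolding lesspoll_def using lepoll_antisym eqpoll_imp_lepoll eqpoll_sym by blast
qed

lemma UN_lepoll_infinite:
  assumes "infinite B" "X \<lesssim> B" "\<And>x. x \<in> X \<Longrightarrow> F x \<lesssim> B"
  shows "(\<Union>x\<in>X. F x) \<lesssim> B"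
  using card_of_UNION_ordLeq_infinite[of B X F] assms unfolding lepoll_iff_ordLeq by blast

lemma Un_lesspoll_infinite:
  assumes "infinite C" "A \<prec> C" "B \<prec> C"
  shows "A \<union> B \<prec> C"
  using card_of_Un_ordLess_infinite[of C A B] assms
  unfolding lesspoll_iff_not_lepoll lepoll_iff_ordLeq
  by (simp add: not_ordLeq_iff_ordLess[OF card_of_Well_order card_of_Well_order])

lemma square_lesspoll_infinite:
  assumes "infinite C" "A \<prec> C"
  shows "A \<times> A \<prec> C"
proof (cases "finite A")
  case True
  then show ?thesis using assms(1) by (intro finite_lesspoll_infinite) auto
next
  case False
  then have "A \<times> A \<approx> A"
    unfolding eqpoll_iff_card_of_ordIso by (rule card_of_Times_same_infinite)
  then show ?thesis using assms(2) eq_lesspoll_trans by blast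
qed

lemma infinite_omega1: "infinite (elts (omega1 :: 'v::zfc_universe))"
  using uncountable_omega1 countable_finite by blast

lemma countable_lepoll_omega1: "countable X \<Longrightarrow> X \<lesssim> elts (omega1 :: 'v::zfc_universe)"
  using infinite_omega1 by (metis countable_lepoll lepoll_iff_leqpoll lesspoll_iff_not_lepoll uncountable_omega1)

lemma omega1_lepoll_omega2: "elts (omega1 :: 'v::zfc_universe) \<lesssim> elts (omega2 :: 'v)"
  using omega2_not_lepoll by (metis lesspoll_iff_not_lepoll lesspoll_imp_lepoll)

lemma infinite_omega2: "infinite (elts (omega2 :: 'v::zfc_universe))"
  using infinite_omega1 omega1_lepoll_omega2 lepoll_trans infinite_le_lepoll by blast


subsection \<open>Namba trees\<close>

lemma funs_mem: "f \<in> funs A B \<Longrightarrow> z \<in> elts f \<Longrightarrow> \<exists>a\<in>elts A. \<exists>b\<in>elts B. z = vpair a b"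
  unfolding funs_def by blast

lemma funs_dom: "f \<in> funs A B \<Longrightarrow> a \<in> elts A \<Longrightarrow> \<exists>b. vpair a b \<in> elts f"
  unfolding funs_def by blast

lemma funs_unique: "f \<in> funs A B \<Longrightarrow> vpair a b \<in> elts f \<Longrightarrow> vpair a c \<in> elts f \<Longrightarrow> b = c"
  using funs_mem[of f A B "vpair a b"] unfolding funs_def by auto

lemma fin_seqs_eq: "fin_seqs = (\<Union>k. funs (vnat k) (omega2 :: 'v::zfc_universe))"
  unfolding fin_seqs_def elts_aleph_0 omega2_def by simp

definition seq_len :: "'v::zfc_universe \<Rightarrow> nat" where
  "seq_len f = (THE k. f \<in> funs (vnat k) omega2)"

lemma seq_len_eq:
  fixes f :: "'v::zfc_universe"
  assumes "f \<in> funs (vnat k) omega2"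
  shows "seq_len f = k"
  unfolding seq_len_def
proof (rule the_equality)
  show "f \<in> funs (vnat k) omega2" by (rule assms)
  fix l assume l: "f \<in> funs (vnat l) omega2"
  have "elts (vnat l :: 'v) = elts (vnat k)"
    using funs_mem[OF l] funs_mem[OF assms] funs_dom[OF l] funs_dom[OF assms] by fastforce
  then show "l = k" using extensionality vnat_inject by metis
qed

lemma fin_seqs_linear:
  assumes "x \<in> fin_seqs" "y \<in> fin_seqs" "z \<in> fin_seqs" "elts x \<subseteq> elts z" "elts y \<subseteq> elts z"
    "seq_len x \<le> seq_len y"
  shows "elts x \<subseteq> elts y"
proof
  obtain i j k where f: "x \<in> funs (vnat i) omega2" "y \<in> funs (vnat j) omega2" "z \<in> funs (vnat k) omega2"
    using assms(1-3) unfolding fin_seqs_eq by blast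
  then have "i \<le> j" using assms(6) by (simp add: seq_len_eq)
  fix p assume p: "p \<in> elts x"
  then obtain a b where ab: "a \<in> elts (vnat i)" "p = vpair a b" using funs_mem[OF f(1)] by blast
  then have "a \<in> elts (vnat j)" using \<open>i \<le> j\<close> by (auto simp: elts_vnat)
  then obtain c where c: "vpair a c \<in> elts y" using funs_dom[OF f(2)] by blast
  have "b = c" by (rule funs_unique[OF f(3)]) (use p ab c assms(4,5) in auto)
  then show "p \<in> elts y" using c ab by simp
qed

lemma funs_vnat_lepoll: "funs (vnat k) (omega2 :: 'v::zfc_universe) \<lesssim> elts (omega2 :: 'v)"
proof (induct k)
  case 0
  have "funs (vnat 0) (omega2 :: 'v) \<subseteq> {vset {}}"
  proof
    fix f :: 'v assume "f \<in> funs (vnat 0) omega2"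
    then have "elts f = {}" using funs_mem[of f "vnat 0"] elts_vnat[of 0] by blast
    then show "f \<in> {vset {}}"
      by (simp add: extensionality elts_vset_small small_countable)
  qed
  then show ?case
    using infinite_omega2 by (meson finite.emptyI finite.insertI finite_lepoll_infinite finite_subset)
next
  case (Suc k)
  define ext where "ext = (\<lambda>(g::'v, b). vset (insert (vpair (vnat k) b) (elts g)))"
  have "funs (vnat (Suc k)) (omega2 :: 'v) \<subseteq> ext ` (funs (vnat k) omega2 \<times> elts omega2)"
  proof
    fix f :: 'v assume f: "f \<in> funs (vnat (Suc k)) omega2"
    define g where "g = vset {z\<in>elts f. \<exists>a\<in>elts (vnat k). \<exists>b. z = vpair a b}"
    have g: "elts g = {z\<in>elts f. \<exists>a\<in>elts (vnat k). \<exists>b. z = vpair a b}"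
      unfolding g_def by (rule elts_vset_small, rule small_subset[OF small_elts[of f]]) blast
    have dom: "elts (vnat (Suc k) :: 'v) = insert (vnat k) (elts (vnat k))"
      unfolding elts_vnat lessThan_Suc by simp
    obtain b where b: "vpair (vnat k) b \<in> elts f" using funs_dom[OF f] dom by blast
    then have "b \<in> elts omega2" using funs_mem[OF f b] by auto
    have "g \<in> funs (vnat k) omega2"
      unfolding funs_def
    proof (intro CollectI conjI ballI)
      show "elts g \<subseteq> {vpair a b |a b. a \<in> elts (vnat k) \<and> b \<in> elts omega2}"
        using funs_mem[OF f] unfolding g by fastforce
      fix a assume a: "a \<in> elts (vnat k :: 'v)"
      then obtain c where "vpair a c \<in> elts f" using funs_dom[OF f] dom by blast
      then show "\<exists>!b. vpair a b \<in> elts g"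
        using a funs_unique[OF f] unfolding g by (intro ex1I[of _ c]) auto
    qed
    moreover have "f = ext (g, b)"
    proof (rule extensionality)
      have "elts f = insert (vpair (vnat k) b) (elts g)"
        using funs_mem[OF f] funs_unique[OF f b] b unfolding g dom by blast
      then show "elts f = elts (ext (g, b))"
        by (simp add: ext_def elts_vset_small small_insert)
    qed
    ultimately show "f \<in> ext ` (funs (vnat k) omega2 \<times> elts omega2)"
      using \<open>b \<in> elts omega2\<close> by blast
  qed
  then have "funs (vnat (Suc k)) (omega2 :: 'v) \<lesssim> funs (vnat k) (omega2 :: 'v) \<times> elts (omega2 :: 'v)"
    by (rule subset_image_lepoll)
  also have "\<dots> \<lesssim> elts (omega2 :: 'v) \<times> elts (omega2 :: 'v)"
    using Suc by (intro times_lepoll_mono) auto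
  also have "\<dots> \<approx> elts (omega2 :: 'v)"
    using infinite_omega2 unfolding eqpoll_iff_card_of_ordIso by (rule card_of_Times_same_infinite)
  finally show ?case .
qed

lemma fin_seqs_lepoll: "(fin_seqs :: 'v::zfc_universe set) \<lesssim> elts (omega2 :: 'v)"
  unfolding fin_seqs_eq
proof (rule UN_lepoll_infinite[OF infinite_omega2])
  show "(UNIV :: nat set) \<lesssim> elts (omega2 :: 'v)" using infinite_omega2 infinite_le_lepoll by blast
qed (rule funs_vnat_lepoll)

interpretation nt: large_tree "fin_seqs :: 'v::zfc_universe set" "\<lambda>x y. elts x \<subseteq> elts y" seq_len
  "\<lambda>X. X \<lesssim> elts (omega1 :: 'v)"
proof
  show "(\<Union>n::nat. F n) \<lesssim> elts (omega1 :: 'v)" if "\<And>n. F n \<lesssim> elts (omega1 :: 'v)" for F :: "nat \<Rightarrow> 'v set"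
    using that infinite_omega1 infinite_le_lepoll by (intro UN_lepoll_infinite) blast+
  show "A \<lesssim> elts (omega1 :: 'v)" if "B \<lesssim> elts (omega1 :: 'v)" "A \<subseteq> B" for A B :: "'v set"
    using that lepoll_trans subset_imp_lepoll by blast
  show "{x} \<lesssim> elts (omega1 :: 'v)" for x :: 'v
    by (rule countable_lepoll_omega1) simp
  show "x = y" if "elts x \<subseteq> elts y" "elts y \<subseteq> elts x" for x y :: 'v
    by (rule extensionality) (use that in blast)
  show "elts x \<subseteq> elts y" if "x \<in> fin_seqs" "y \<in> fin_seqs" "z \<in> fin_seqs" "elts x \<subseteq> elts z"
    "elts y \<subseteq> elts z" "seq_len x \<le> seq_len y" for x y z :: 'v
    using that by (rule fin_seqs_linear)
qed auto

text \<open>Translates the aleph_2 of the Namba trees into positivity for the ideal: all finite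
  sequences together have size at most aleph_2, and no size lies between aleph_1 and
  aleph_2.\<close>

lemma eqpoll_omega2_iff:
  fixes X :: "'v::zfc_universe set"
  assumes "X \<subseteq> fin_seqs"
  shows "X \<approx> elts (omega2 :: 'v) \<longleftrightarrow> \<not> X \<lesssim> elts (omega1 :: 'v)"
proof
  assume "X \<approx> elts (omega2 :: 'v)"
  then show "\<not> X \<lesssim> elts (omega1 :: 'v)"
    using omega2_not_lepoll eqpoll_sym lepoll_trans1 by blast
next
  assume "\<not> X \<lesssim> elts (omega1 :: 'v)"
  moreover have "X \<lesssim> elts (omega2 :: 'v)"
    using assms fin_seqs_lepoll lepoll_trans subset_imp_lepoll by blast
  ultimately show "X \<approx> elts (omega2 :: 'v)" by (intro eqpoll_omega2)
qed

lemma namba_trees_iff: "(T :: 'v::zfc_universe) \<in> namba_trees \<longleftrightarrow> nt.tree (elts T)"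
proof -
  have "{\<tau>\<in>elts T. elts \<eta> \<subseteq> elts \<tau>} \<approx> elts (omega2 :: 'v) \<longleftrightarrow> \<not> {\<tau>\<in>elts T. elts \<eta> \<subseteq> elts \<tau>} \<lesssim> elts (omega1 :: 'v)"
    if "elts T \<subseteq> fin_seqs" for T \<eta> :: 'v
    by (rule eqpoll_omega2_iff) (use that in blast)
  then show ?thesis
    unfolding namba_trees_def nt.tree_def omega2_def[symmetric] by auto
qed

lemma small_fin_seqs: "small fin_seqs"
  by (rule small_lepoll[OF fin_seqs_lepoll])

lemma small_namba_trees: "small namba_trees"
  by (rule small_subset[OF small_Pow[OF small_fin_seqs]]) (auto simp: namba_trees_def)

lemma conds_vpair: "conds (vpair A R) = elts A"
  unfolding conds_def by simp

lemma leq_vpair: "leq (vpair A R) q p \<longleftrightarrow> q \<in> elts A \<and> p \<in> elts A \<and> vpair q p \<in> elts R"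
  unfolding leq_def conds_vpair by simp

lemma conds_namba: "conds namba = namba_trees"
  unfolding namba_def conds_vpair by (rule elts_vset_small[OF small_namba_trees])

lemma elts_namba_order:
  "elts (vset {vpair T' T |T' T. T' \<in> namba_trees \<and> T \<in> namba_trees \<and> elts T' \<subseteq> elts T}) =
     {vpair T' T |T' T. T' \<in> namba_trees \<and> T \<in> namba_trees \<and> elts T' \<subseteq> elts T}"
  by (rule elts_vset_small, rule small_subset[OF small_pairs[OF small_namba_trees small_namba_trees]])
    blast

lemma leq_namba: "leq namba q p \<longleftrightarrow> q \<in> namba_trees \<and> p \<in> namba_trees \<and> elts q \<subseteq> elts p"
  unfolding namba_def leq_vpair elts_namba_order elts_vset_small[OF small_namba_trees] by auto

lemma namba_vpair:
  "\<exists>A R. namba = vpair A R \<and> elts R \<subseteq> {vpair q p |q p. q \<in> elts A \<and> p \<in> elts A}"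
  by (intro exI conjI, rule namba_def, unfold elts_namba_order elts_vset_small[OF small_namba_trees])
    blast

lemma poset_namba: "poset (namba :: 'v::zfc_universe)"
  unfolding poset_def
proof (intro conjI namba_vpair allI impI)
  show "p = q" if "leq namba p q" "leq namba q p" for p q :: 'v
    by (rule extensionality) (use that in \<open>auto simp: leq_namba\<close>)
qed (auto simp: conds_namba leq_namba)


subsection \<open>Forcing equality of names\<close>

lemma poset_refl: "poset P \<Longrightarrow> p \<in> conds P \<Longrightarrow> leq P p p"
  unfolding poset_def by blast

lemma poset_trans: "poset P \<Longrightarrow> leq P p q \<Longrightarrow> leq P q r \<Longrightarrow> leq P p r"
  unfolding poset_def by blast

lemma leq_conds: "leq P q p \<Longrightarrow> q \<in> conds P"
  unfolding leq_def by blast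

lemma forces_eq_mono: "poset P \<Longrightarrow> forces_eq P p x y \<Longrightarrow> leq P q p \<Longrightarrow> forces_eq P q x y"
  unfolding forces_eq.simps[of P _ x y] using poset_trans by meson

lemma forces_eq_sym: "forces_eq P p x y \<Longrightarrow> forces_eq P p y x"
  unfolding forces_eq.simps[of P p x y] forces_eq.simps[of P p y x] by blast

lemma forces_eq_left:
  "forces_eq P p x y \<Longrightarrow> vpair \<sigma> s \<in> elts x \<Longrightarrow> leq P q p \<Longrightarrow> leq P q s \<Longrightarrow> forces_mem P q \<sigma> y"
  unfolding forces_eq.simps[of P p x y] by blast

lemma forces_mem_step:
  "forces_mem P p x y \<Longrightarrow> leq P q p \<Longrightarrow>
     \<exists>r \<sigma> s. vpair \<sigma> s \<in> elts y \<and> leq P r q \<and> leq P r s \<and> forces_eq P r x \<sigma>"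
  unfolding forces_mem.simps[of P p x y] by blast

text \<open>The induction is on \<open>x\<close> alone. For the inclusion starting from
  \<open>z\<close>, the chain of forced equalities ends in an element of \<open>x\<close> and is
  read backwards before the hypothesis applies; hence \<open>half\<close> leaves its two equalities
  uncomposed.\<close>

lemma forces_eq_trans:
  assumes P: "poset P"
  shows "forces_eq P p x y \<Longrightarrow> forces_eq P p y z \<Longrightarrow> forces_eq P p x z"
proof (induct x arbitrary: p y z rule: wf_induct_rule[OF wf_trancl[OF wf_memrel]])
  case (1 x)
  have half: "\<exists>r \<zeta> w. vpair \<zeta> w \<in> elts c \<and> leq P r q' \<and> leq P r w \<and>
      (\<exists>\<rho>. forces_eq P r \<sigma> \<rho> \<and> forces_eq P r \<rho> \<zeta>)"
    if h: "forces_eq P p a b" "forces_eq P p b c" "vpair \<sigma> s \<in> elts a" "leq P q p" "leq P q s"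
      "leq P q' q" for a b c q q' \<sigma> s
  proof -
    obtain r \<rho> u where r: "vpair \<rho> u \<in> elts b" "leq P r q'" "leq P r u" "forces_eq P r \<sigma> \<rho>"
      using forces_mem_step[OF forces_eq_left[OF h(1,3,4,5)] h(6)] by blast
    have rp: "leq P r p" using r(2) h poset_trans[OF P] by blast
    have "leq P r r" using poset_refl[OF P leq_conds[OF r(2)]] .
    then obtain r' \<zeta> w where r': "vpair \<zeta> w \<in> elts c" "leq P r' r" "leq P r' w" "forces_eq P r' \<rho> \<zeta>"
      using forces_mem_step[OF forces_eq_left[OF h(2) r(1) rp r(3)]] by blast
    show ?thesis
      using r' forces_eq_mono[OF P r(4) r'(2)] poset_trans[OF P r'(2) r(2)] by blast
  qed
  show ?case
    unfolding forces_eq.simps[of P p x z] forces_mem.simps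
  proof (intro conjI allI impI; elim conjE)
    fix \<sigma> s q q' assume h: "vpair \<sigma> s \<in> elts x" "leq P q p" "leq P q s" "leq P q' q"
    show "\<exists>r \<sigma>' s. vpair \<sigma>' s \<in> elts z \<and> leq P r q' \<and> leq P r s \<and> forces_eq P r \<sigma> \<sigma>'"
      using half[OF 1(2,3) h] 1(1)[OF vpair_fst_memrel[OF h(1)]] by meson
  next
    fix \<sigma> s q q' assume h: "vpair \<sigma> s \<in> elts z" "leq P q p" "leq P q s" "leq P q' q"
    obtain r \<zeta> w \<rho> where r: "vpair \<zeta> w \<in> elts x" "leq P r q'" "leq P r w"
      "forces_eq P r \<sigma> \<rho>" "forces_eq P r \<rho> \<zeta>"
      using half[OF forces_eq_sym[OF 1(3)] forces_eq_sym[OF 1(2)] h] by blast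
    have "forces_eq P r \<zeta> \<sigma>"
      by (rule 1(1)[OF vpair_fst_memrel[OF r(1)]]) (use r forces_eq_sym in blast)+
    then show "\<exists>r \<sigma>' s. vpair \<sigma>' s \<in> elts x \<and> leq P r q' \<and> leq P r s \<and> forces_eq P r \<sigma> \<sigma>'"
      using r forces_eq_sym by blast
  qed
qed

lemma elts_check: "elts (check P x) = (\<Union>y\<in>elts x. vpair (check P y) ` conds P)"
proof -
  have "small (\<Union>y\<in>elts x. vpair (check P y) ` conds P)"
    by (intro small_UN small_image small_elts) (simp add: conds_def)
  then show ?thesis by (subst check.simps) (rule elts_vset_small)
qed

lemma is_name_check: "is_name P (check P x)"
proof (induct x rule: mem_induct)
  case (mem x)
  show ?case by (rule is_name.intros) (use mem in \<open>auto simp: elts_check\<close>)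
qed

text \<open>Each element of one set is forced, by some stronger condition, equal to an element of
  the other, and induction applies to these. As check names carry every condition, \<open>r\<close>
  itself can be paired with the element.\<close>

lemma check_forces_eq_imp_eq:
  assumes P: "poset P"
  shows "r \<in> conds P \<Longrightarrow> forces_eq P r (check P x) (check P y) \<Longrightarrow> x = y"
proof (induct x arbitrary: y r rule: mem_induct)
  case (mem x)
  have sub: "\<exists>w\<in>elts b. \<exists>r'\<in>conds P. forces_eq P r' (check P z) (check P w)"
    if "forces_eq P r (check P a) (check P b)" "z \<in> elts a" for a b z
  proof -
    have rr: "leq P r r" using poset_refl[OF P mem(2)] .
    have "vpair (check P z) r \<in> elts (check P a)" using that(2) mem(2) by (auto simp: elts_check)
    from forces_mem_step[OF forces_eq_left[OF that(1) this rr rr] rr]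
    obtain r' \<sigma> s where r': "vpair \<sigma> s \<in> elts (check P b)" "leq P r' r" "forces_eq P r' (check P z) \<sigma>"
      by blast
    from r'(1) obtain w where "w \<in> elts b" "\<sigma> = check P w" by (auto simp: elts_check)
    then show ?thesis using r'(3) leq_conds[OF r'(2)] by blast
  qed
  show ?case
  proof (rule extensionality, intro equalityI subsetI)
    fix z assume z: "z \<in> elts x"
    then show "z \<in> elts y" using sub[OF mem(3) z] mem(1)[OF z] by blast
  next
    fix z assume z: "z \<in> elts y"
    then show "z \<in> elts x" using sub[OF forces_eq_sym[OF mem(3)] z] mem(1) forces_eq_sym by blast
  qed
qed

section \<open>Bounding countably many names in Namba forcing\<close>

lemma namba_bounded:
  fixes \<tau> :: "nat \<Rightarrow> 'v::zfc_universe"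
  assumes q: "q \<in> conds namba"
  shows "\<exists>\<delta>\<in>elts omega1. \<exists>T. leq namba T q \<and> (\<forall>n. \<forall>\<gamma>\<in>elts omega1. \<delta> \<in> elts \<gamma> \<longrightarrow>
           \<not> (\<exists>r. leq namba r T \<and> forces_eq namba r (\<tau> n) (check namba \<gamma>)))"
proof -
  let ?F = "\<lambda>r n \<gamma>. forces_eq namba r (\<tau> n) (check namba \<gamma>)"
  \<comment> \<open>A weak form of deciding, meaningful for arbitrary sets \<open>\<tau> n\<close>:
    no condition inside \<open>T\<close> forces a countable ordinal other than
    \<open>\<beta>\<close>. If none forces any, every \<open>\<beta>\<close> is accepted.\<close>
  define dec where "dec n T \<beta> \<longleftrightarrow> (\<forall>\<gamma>\<in>elts omega1. \<forall>r. r \<in> namba_trees \<and> elts r \<subseteq> T \<and> ?F r n \<gamma> \<longrightarrow> \<gamma> = \<beta>)"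
    for n T \<beta>
  have "\<exists>\<delta>\<in>elts omega1. \<exists>T\<subseteq>elts q. nt.tree T \<and> (\<forall>n r. r \<subseteq> T \<and> nt.tree r \<longrightarrow>
           (\<exists>r' T' \<beta>. r' \<subseteq> r \<and> nt.tree r' \<and> r' \<subseteq> T' \<and> nt.tree T' \<and> \<beta> \<in> elts omega1 \<and>
             dec n T' \<beta> \<and> \<beta> \<in> elts \<delta>))"
  proof (rule nt.fusion)
    show "nt.tree (elts q)" using q by (simp add: conds_namba namba_trees_iff)
    show "\<exists>\<delta>\<in>elts omega1. \<forall>n. f n \<in> elts \<delta>" if "range f \<subseteq> elts omega1" for f :: "nat \<Rightarrow> 'v"
      by (rule omega1_bounded) (use that in blast)
    show "(\<Union>d\<in>elts omega1. F d) \<lesssim> elts (omega1 :: 'v)"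
      if "\<And>d. d \<in> elts omega1 \<Longrightarrow> F d \<lesssim> elts (omega1 :: 'v)" for F :: "'v \<Rightarrow> 'v set"
      using that by (intro UN_lepoll_infinite infinite_omega1) auto
    show "\<exists>T'\<subseteq>T. nt.tree T' \<and> (\<exists>\<beta>\<in>elts omega1. dec n T' \<beta>)" if T: "nt.tree T" for n and T :: "'v set"
    proof (cases "\<exists>r. \<exists>\<gamma>\<in>elts omega1. r \<in> namba_trees \<and> elts r \<subseteq> T \<and> ?F r n \<gamma>")
      case True
      then obtain r \<gamma> where r: "\<gamma> \<in> elts omega1" "r \<in> namba_trees" "elts r \<subseteq> T" "?F r n \<gamma>" by blast
      have "dec n (elts r) \<gamma>"
        unfolding dec_def
      proof (intro ballI allI impI; elim conjE)
        fix \<gamma>' r' assume h: "r' \<in> namba_trees" "elts r' \<subseteq> elts r" "?F r' n \<gamma>'"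
        have "leq namba r' r" using h r by (simp add: leq_namba)
        then have "?F r' n \<gamma>" using forces_eq_mono[OF poset_namba r(4)] by blast
        then have "forces_eq namba r' (check namba \<gamma>') (check namba \<gamma>)"
          using forces_eq_trans[OF poset_namba] forces_eq_sym h(3) by blast
        then show "\<gamma>' = \<gamma>"
          using check_forces_eq_imp_eq[OF poset_namba] h(1) conds_namba by blast
      qed
      then show ?thesis using r namba_trees_iff by blast
    next
      case False
      obtain \<beta> :: 'v where "\<beta> \<in> elts omega1" using infinite_omega1 by (metis finite.emptyI all_not_in_conv)
      moreover have "dec n T \<beta>" using False unfolding dec_def by blast
      ultimately show ?thesis using T by blast
    qed
  qed
  then obtain \<delta> T where \<delta>: "\<delta> \<in> elts omega1" and T: "T \<subseteq> elts q" "nt.tree T" and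
    main: "\<forall>n r. r \<subseteq> T \<and> nt.tree r \<longrightarrow>
           (\<exists>r' T' \<beta>. r' \<subseteq> r \<and> nt.tree r' \<and> r' \<subseteq> T' \<and> nt.tree T' \<and> \<beta> \<in> elts omega1 \<and>
             dec n T' \<beta> \<and> \<beta> \<in> elts \<delta>)"
    by (elim bexE exE conjE) (rule that; assumption)
  have sm: "small X" if "nt.tree X" for X :: "'v set"
    using that small_subset[OF small_fin_seqs] unfolding nt.tree_def by blast
  have vT: "elts (vset T) = T" by (rule elts_vset_small[OF sm[OF T(2)]])
  have "\<not> ?F r n \<gamma>"
    if h: "\<gamma> \<in> elts omega1" "\<delta> \<in> elts \<gamma>" "leq namba r (vset T)" for n \<gamma> r
  proof
    assume F: "?F r n \<gamma>"
    have "elts r \<subseteq> T" "nt.tree (elts r)" using h(3) by (auto simp: leq_namba vT namba_trees_iff)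
    from main[rule_format, OF conjI[OF this], of n] obtain r' T' \<beta> where r': "r' \<subseteq> elts r" "nt.tree r'" "r' \<subseteq> T'"
      "dec n T' \<beta>" "\<beta> \<in> elts \<delta>" by blast
    have e: "elts (vset r') = r'" by (rule elts_vset_small[OF sm[OF r'(2)]])
    then have t: "vset r' \<in> namba_trees" using r'(2) by (simp add: namba_trees_iff)
    then have "leq namba (vset r') r" using h(3) r'(1) e by (simp add: leq_namba)
    then have "?F (vset r') n \<gamma>" using forces_eq_mono[OF poset_namba F] by blast
    moreover have "elts (vset r') \<subseteq> T'" using r'(3) e by simp
    ultimately have "\<gamma> = \<beta>" using r'(4) t h(1) unfolding dec_def by blast
    then show False using r'(5) h(2) mem_not_sym by blast
  qed
  moreover have "leq namba (vset T) q"
    using T q vT by (simp add: leq_namba conds_namba namba_trees_iff)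
  ultimately show ?thesis
    by (intro bexI[OF _ \<delta>] exI[of _ "vset T"]) simp
qed


subsection \<open>Membership in \<open>H\<close>\<close>

definition closed :: "'v::zfc_universe set \<Rightarrow> bool" where
  "closed X \<longleftrightarrow> (\<forall>x\<in>X. elts x \<subseteq> X)"

lemma closedD: "closed X \<Longrightarrow> x \<in> X \<Longrightarrow> y \<in> elts x \<Longrightarrow> y \<in> X"
  unfolding closed_def by blast

abbreviation TC :: "'v::zfc_universe \<Rightarrow> 'v set" where
  "TC x \<equiv> {y. (y, x) \<in> memrel\<^sup>+}"

lemma elts_TC: "elts x \<subseteq> TC x"
  by (auto simp: memrel_def)

lemma closed_TC: "closed (TC x)"
  unfolding closed_def by (auto simp: memrel_def intro: trancl_into_trancl2)

lemma TC_least: "closed X \<Longrightarrow> elts x \<subseteq> X \<Longrightarrow> TC x \<subseteq> X"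
proof (intro subsetI, simp)
  fix y assume h: "closed X" "elts x \<subseteq> X" "(y, x) \<in> memrel\<^sup>+"
  from h(3) show "y \<in> X"
    by (induct rule: converse_trancl_induct) (use h closedD in \<open>auto simp: memrel_def\<close>)
qed

lemma closed_H: "closed (H \<theta>)"
  unfolding closed_def
proof (intro ballI subsetI)
  fix x y assume h: "x \<in> H \<theta>" "y \<in> elts x"
  have "TC y \<subseteq> TC x"
    using TC_least[OF closed_TC] closedD[OF closed_TC] elts_TC h(2) by blast
  then show "y \<in> H \<theta>"
    using h(1) lesspoll_trans1 subset_imp_lepoll unfolding H_def by blast
qed

lemma H_memI: "closed X \<Longrightarrow> X \<prec> elts \<theta> \<Longrightarrow> elts x \<subseteq> X \<Longrightarrow> x \<in> H \<theta>"
  unfolding H_def mem_Collect_eq by (rule lesspoll_trans1[OF subset_imp_lepoll[OF TC_least]])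

text \<open>Keeping \<open>X\<close> makes two rounds yield the Kuratowski pairs over
  \<open>X\<close> together with the sets between them and \<open>X\<close>, which preserves
  transitivity.\<close>

definition upairs :: "'v::zfc_universe set \<Rightarrow> 'v set" where
  "upairs X = X \<union> (\<lambda>(a, b). vset {a, b}) ` (X \<times> X)"

definition pairs :: "'v::zfc_universe set \<Rightarrow> 'v set" where
  "pairs X = upairs (upairs X)"

lemma subset_upairs: "X \<subseteq> upairs X"
  unfolding upairs_def by blast

lemma subset_pairs: "X \<subseteq> pairs X"
  unfolding pairs_def using subset_upairs by blast

lemma upairs_I: "a \<in> X \<Longrightarrow> b \<in> X \<Longrightarrow> vset {a, b} \<in> upairs X"
  unfolding upairs_def by force

lemma upairs_E:
  assumes "x \<in> upairs X"
  obtains "x \<in> X" | "elts x \<subseteq> X"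
proof -
  have "elts (vset {a, b}) = {a, b}" for a b :: 'a
    by (rule elts_vset_small[OF small_doubleton])
  then show ?thesis using assms that unfolding upairs_def by auto
qed

lemma vpair_pairs:
  assumes "a \<in> X" "b \<in> X"
  shows "vpair a b \<in> pairs X"
proof -
  have "vset {a} \<in> upairs X" using upairs_I[OF assms(1,1)] by simp
  from upairs_I[OF this upairs_I[OF assms]] show ?thesis
    unfolding pairs_def vpair_def .
qed

text \<open>The hypothesis allows for an \<open>X\<close> that is not closed, such as one containing
  check names, whose elements are pairs over \<open>X\<close>.\<close>

lemma closed_pairs:
  assumes "\<And>x. x \<in> X \<Longrightarrow> elts x \<subseteq> pairs X"
  shows "closed (pairs X)"
  unfolding closed_def
proof
  fix x assume "x \<in> pairs X"
  then show "elts x \<subseteq> pairs X"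
    unfolding pairs_def
  proof (cases rule: upairs_E)
    case 1
    then show "elts x \<subseteq> upairs (upairs X)"
      using assms subset_pairs[of X] unfolding pairs_def by (cases rule: upairs_E) auto
  next
    case 2
    then show "elts x \<subseteq> upairs (upairs X)" using subset_upairs by blast
  qed
qed

lemma closed_pairs_closed: "closed X \<Longrightarrow> closed (pairs X)"
  by (rule closed_pairs) (use subset_pairs closed_def in blast)

lemma upairs_lesspoll: "infinite C \<Longrightarrow> X \<prec> C \<Longrightarrow> upairs X \<prec> C"
  unfolding upairs_def
  using square_lesspoll_infinite image_lepoll lesspoll_trans1 by (intro Un_lesspoll_infinite) blast+

lemma pairs_lesspoll: "infinite C \<Longrightarrow> X \<prec> C \<Longrightarrow> pairs X \<prec> C"
  unfolding pairs_def by (simp add: upairs_lesspoll)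

lemma vpair_mem_closed:
  assumes "closed X" "vpair a b \<in> X"
  shows "a \<in> X" "b \<in> X"
proof -
  have *: "elts (vset {a, b}) = {a, b}" by (rule elts_vset_small[OF small_doubleton])
  have "vset {a, b} \<in> X" using closedD[OF assms] by (simp add: elts_vpair)
  then show "a \<in> X" "b \<in> X" using closedD[OF assms(1)] * by blast+
qed


subsection \<open>Definability\<close>

text \<open>A semantic layer over \<open>fm\<close>: closure rules for predicates on environments
  build the formulas, so that these never have to be written out.\<close>

definition definable :: "'v::zfc_universe set \<Rightarrow> ((nat \<Rightarrow> 'v) \<Rightarrow> bool) \<Rightarrow> bool" where
  "definable A Q \<longleftrightarrow> (\<exists>\<phi>. \<forall>e. range e \<subseteq> A \<longrightarrow> (sat A \<phi> e \<longleftrightarrow> Q e))"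

lemma definable_mem: "definable A (\<lambda>e. e i \<in> elts (e j))"
  unfolding definable_def by (intro exI[of _ "Mem i j"]) simp

lemma definable_eq: "definable A (\<lambda>e. e i = e j)"
  unfolding definable_def by (intro exI[of _ "Eq i j"]) simp

lemma definable_not: "definable A Q \<Longrightarrow> definable A (\<lambda>e. \<not> Q e)"
  unfolding definable_def by (elim exE, rule_tac x = "Neg \<phi>" in exI) simp

lemma definable_conj: "definable A Q \<Longrightarrow> definable A Q' \<Longrightarrow> definable A (\<lambda>e. Q e \<and> Q' e)"
  unfolding definable_def by (elim exE, rule_tac x = "And \<phi> \<phi>'" in exI) simp

lemma definable_disj: "definable A Q \<Longrightarrow> definable A Q' \<Longrightarrow> definable A (\<lambda>e. Q e \<or> Q' e)"
  using definable_not[OF definable_conj[OF definable_not definable_not, of A Q Q']] by simp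

lemma definable_imp: "definable A Q \<Longrightarrow> definable A Q' \<Longrightarrow> definable A (\<lambda>e. Q e \<longrightarrow> Q' e)"
  using definable_disj[OF definable_not, of A Q Q'] by simp

lemma definable_iff: "definable A Q \<Longrightarrow> definable A Q' \<Longrightarrow> definable A (\<lambda>e. Q e \<longleftrightarrow> Q' e)"
  using definable_conj[OF definable_imp definable_imp, of A Q Q' Q' Q]
  by (simp add: iff_conv_conj_imp)

lemma definable_False: "definable A (\<lambda>e. False)"
  using definable_not[OF definable_eq, of A 0 0] by simp

text \<open>The freshness condition says that \<open>n\<close> is not free in \<open>Q\<close>.\<close>

lemma definable_all:
  assumes fresh: "\<forall>e x y. Q x (e(n := y)) = Q x e" and "definable A (\<lambda>e. Q (e n) e)"
  shows "definable A (\<lambda>e. \<forall>x\<in>A. Q x e)"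
proof -
  obtain \<phi> where \<phi>: "\<And>e. range e \<subseteq> A \<Longrightarrow> sat A \<phi> e \<longleftrightarrow> Q (e n) e"
    using assms(2) unfolding definable_def by blast
  have "sat A (All n \<phi>) e \<longleftrightarrow> (\<forall>x\<in>A. Q x e)" if "range e \<subseteq> A" for e
  proof -
    have "sat A \<phi> (e(n := x)) \<longleftrightarrow> Q x e" if "x \<in> A" for x
    proof -
      have "range (e(n := x)) \<subseteq> A" using \<open>range e \<subseteq> A\<close> that by auto
      then show ?thesis using \<phi> fresh by simp
    qed
    then show ?thesis by simp
  qed
  then show ?thesis unfolding definable_def by blast
qed

lemma definable_ex:
  assumes "\<forall>e x y. Q x (e(n := y)) = Q x e" "definable A (\<lambda>e. Q (e n) e)"
  shows "definable A (\<lambda>e. \<exists>x\<in>A. Q x e)"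
  using definable_not[OF definable_all[of "\<lambda>x e. \<not> Q x e" n A]] definable_not[OF assms(2)] assms(1)
  by simp

lemma definable_cong_on:
  assumes "\<And>e. range e \<subseteq> A \<Longrightarrow> Q e = Q' e" "definable A Q"
  shows "definable A Q'"
  using assms unfolding definable_def by simp

text \<open>Elements of \<open>e j\<close> are in the closed set \<open>A\<close> anyway, so a
  quantifier over \<open>A\<close> expresses the bounded one.\<close>

lemma definable_ball:
  assumes A: "closed A" and fresh: "n \<noteq> j \<and> (\<forall>e x y. Q x (e(n := y)) = Q x e)"
    and Q: "definable A (\<lambda>e. Q (e n) e)"
  shows "definable A (\<lambda>e. \<forall>x\<in>elts (e j). Q x e)"
proof (rule definable_cong_on)
  show "(\<forall>x\<in>A. x \<in> elts (e j) \<longrightarrow> Q x e) \<longleftrightarrow> (\<forall>x\<in>elts (e j). Q x e)" if "range e \<subseteq> A" for e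
    using that closedD[OF A, of "e j"] by blast
  show "definable A (\<lambda>e. \<forall>x\<in>A. x \<in> elts (e j) \<longrightarrow> Q x e)"
    by (rule definable_all[where n = n], use fresh in simp, intro definable_imp definable_mem Q)
qed

lemma definable_bex:
  assumes "closed A" "n \<noteq> j \<and> (\<forall>e x y. Q x (e(n := y)) = Q x e)" "definable A (\<lambda>e. Q (e n) e)"
  shows "definable A (\<lambda>e. \<exists>x\<in>elts (e j). Q x e)"
  using definable_not[OF definable_ball[of A n j "\<lambda>x e. \<not> Q x e"]] definable_not[OF assms(3)] assms(1,2)
  by simp

lemma eq_vpair_iff:
  "z = vpair a b \<longleftrightarrow> (\<exists>u\<in>elts z. \<exists>v\<in>elts z. (\<forall>w\<in>elts z. w = u \<or> w = v) \<and>
     (a \<in> elts u \<and> (\<forall>w\<in>elts u. w = a)) \<and> a \<in> elts v \<and> b \<in> elts v \<and> (\<forall>w\<in>elts v. w = a \<or> w = b))"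
    (is "_ \<longleftrightarrow> ?R")
proof
  have 1: "elts (vset {a, b}) = {a, b}" "elts (vset {a}) = {a}"
    using elts_vset_small[OF small_doubleton[of a b]] elts_vset_small[OF small_doubleton[of a a]] by auto
  show ?R if "z = vpair a b"
    unfolding that elts_vpair by (intro bexI[of _ "vset {a}"] bexI[of _ "vset {a, b}"]) (auto simp: 1)
  assume ?R
  then obtain u v where uv: "u \<in> elts z" "v \<in> elts z" "\<forall>w\<in>elts z. w = u \<or> w = v"
    "elts u = {a}" "elts v = {a, b}" by blast
  have "u = vset {a}" "v = vset {a, b}" by (rule extensionality, simp add: uv 1)+
  moreover have "elts z = {u, v}" using uv by blast
  ultimately show "z = vpair a b" by (intro extensionality) (simp add: elts_vpair)
qed

lemma definable_eq_vpair:
  assumes "closed A"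
  shows "definable A (\<lambda>e. e k = vpair (e i) (e j))"
  unfolding eq_vpair_iff
  \<comment> \<open>The indices from \<open>i+j+k+1\<close> on exceed all free variables, hence are
    fresh.\<close>
  by (rule definable_bex[OF assms, where n = "i+j+k+1"], simp,
      rule definable_bex[OF assms, where n = "i+j+k+2"], simp,
      intro definable_conj definable_mem;
      rule definable_ball[OF assms, where n = "i+j+k+3"], simp, intro definable_disj definable_eq)

lemma definable_vpair_mem:
  assumes "closed A"
  shows "definable A (\<lambda>e. vpair (e i) (e j) \<in> elts (e k))"
proof (rule definable_cong_on)
  show "definable A (\<lambda>e. \<exists>z\<in>elts (e k). z = vpair (e i) (e j))"
    by (rule definable_bex[OF assms, where n = "i+j+k+1"]) (simp_all add: definable_eq_vpair assms)
qed blast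

lemma definable_triple_mem:
  assumes "closed A"
  shows "definable A (\<lambda>e. vpair (e i) (vpair (e j) (e l)) \<in> elts (e k))"
proof (rule definable_cong_on)
  show "definable A (\<lambda>e. \<exists>t\<in>A. t = vpair (e j) (e l) \<and> vpair (e i) t \<in> elts (e k))"
    by (rule definable_ex[where n = "i+j+k+l+1"],
        simp, intro definable_conj definable_eq_vpair definable_vpair_mem assms)
  show "(\<exists>t\<in>A. t = vpair (e j) (e l) \<and> vpair (e i) t \<in> elts (e k)) \<longleftrightarrow>
      vpair (e i) (vpair (e j) (e l)) \<in> elts (e k)" if "range e \<subseteq> A" for e
  proof -
    have "e k \<in> A" using that by blast
    then show ?thesis using vpair_mem_closed(2)[OF assms closedD[OF assms]] by blast
  qed
qed

text \<open>Variable 0 is the witness and 1 to 6 are parameters, as many as \<open>is_bound\<close>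
  takes. Fixed indices from 7 on in later proofs are bound variables.\<close>

lemma elementary_reflect:
  fixes A B :: "'v::zfc_universe set"
  assumes "elementary A B" "definable B (\<lambda>e. Q (e 0) (e 1) (e 2) (e 3) (e 4) (e 5) (e 6))"
    and p: "a1 \<in> A" "a2 \<in> A" "a3 \<in> A" "a4 \<in> A" "a5 \<in> A" "a6 \<in> A"
    and x: "x \<in> B" "Q x a1 a2 a3 a4 a5 a6"
  shows "\<exists>x\<in>A. Q x a1 a2 a3 a4 a5 a6"
proof -
  obtain \<phi> where \<phi>: "\<And>e. range e \<subseteq> B \<Longrightarrow> sat B \<phi> e \<longleftrightarrow> Q (e 0) (e 1) (e 2) (e 3) (e 4) (e 5) (e 6)"
    using assms(2) unfolding definable_def by blast
  have AB: "A \<subseteq> B" and el: "\<And>\<phi> e. range e \<subseteq> A \<Longrightarrow> sat A \<phi> e \<longleftrightarrow> sat B \<phi> e"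
    using assms(1) unfolding elementary_def by auto
  \<comment> \<open>All other variables get \<open>a6\<close>, so that the environment is total with
    values in \<open>A\<close>.\<close>
  define e where "e = (\<lambda>i::nat. if i = 1 then a1 else if i = 2 then a2 else if i = 3 then a3
    else if i = 4 then a4 else if i = 5 then a5 else a6)"
  have eA: "range e \<subseteq> A" using p unfolding e_def by auto
  have eAx: "range (e(0 := y)) \<subseteq> A" if "y \<in> A" for y using eA that by auto
  have eBx: "range (e(0 := y)) \<subseteq> B" if "y \<in> B" for y using eA AB that by auto
  have Q: "sat B \<phi> (e(0 := y)) \<longleftrightarrow> Q y a1 a2 a3 a4 a5 a6" if "y \<in> B" for y
    using \<phi>[OF eBx[OF that]] by (simp add: e_def)
  have "sat B (Exists 0 \<phi>) e" using x Q by auto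
  then have "sat A (Exists 0 \<phi>) e" using el[OF eA, of "Exists 0 \<phi>"] by blast
  then obtain y where y: "y \<in> A" "sat A \<phi> (e(0 := y))" by auto
  then have "sat B \<phi> (e(0 := y))" using el[OF eAx] by blast
  then show ?thesis using Q y(1) AB by blast
qed


declare vnat.simps [simp del] aleph.simps [simp del]

lemma elts_vnat_0 [simp]: "elts (vnat 0) = {}"
  unfolding elts_vnat by simp

lemmas definable_intros = definable_conj definable_disj definable_imp definable_iff definable_not
  definable_mem definable_eq definable_False definable_vpair_mem definable_eq_vpair definable_triple_mem

subsection \<open>Closure properties of countable elementary submodels\<close>

definition is_succ :: "'v::zfc_universe \<Rightarrow> 'v \<Rightarrow> bool" where
  "is_succ y x \<longleftrightarrow> x \<in> elts y \<and> (\<forall>z\<in>elts x. z \<in> elts y) \<and> (\<forall>z\<in>elts y. z \<in> elts x \<or> z = x)"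

text \<open>By foundation, descending through predecessors in \<open>w\<close> ends at 0, so
  \<open>w\<close> has no elements but the natural numbers.\<close>

definition is_omega :: "'v::zfc_universe \<Rightarrow> bool" where
  "is_omega w \<longleftrightarrow> (\<exists>z\<in>elts w. \<forall>y\<in>elts z. False) \<and> (\<forall>x\<in>elts w. \<exists>y\<in>elts w. is_succ y x) \<and>
     (\<forall>x\<in>elts w. (\<forall>y\<in>elts x. False) \<or> (\<exists>y\<in>elts w. is_succ x y))"

text \<open>Cut down to first components in \<open>w\<close> and second components in
  \<open>x\<close>, \<open>g\<close> is a partial function from \<open>w\<close> onto
  \<open>x\<close>; for omega this expresses countability.\<close>

definition enumerates :: "'v::zfc_universe \<Rightarrow> 'v \<Rightarrow> 'v \<Rightarrow> bool" where
  "enumerates w g x \<longleftrightarrow> (\<forall>y\<in>elts x. \<exists>n\<in>elts w. vpair n y \<in> elts g) \<and>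
     (\<forall>n\<in>elts w. \<forall>y\<in>elts x. \<forall>y'\<in>elts x. vpair n y \<in> elts g \<and> vpair n y' \<in> elts g \<longrightarrow> y = y')"

text \<open>The first two clauses make \<open>x\<close> an ordinal. Countability is relative to
  enumerations in \<open>A\<close>; \<open>H \<theta>\<close> contains enough of them for it to be
  true countability.\<close>

definition is_omega1 :: "'v::zfc_universe set \<Rightarrow> 'v \<Rightarrow> 'v \<Rightarrow> bool" where
  "is_omega1 A w x \<longleftrightarrow> (\<forall>y\<in>elts x. \<forall>z\<in>elts y. z \<in> elts x) \<and>
     (\<forall>y\<in>elts x. \<forall>z\<in>elts y. \<forall>u\<in>elts z. u \<in> elts y) \<and>
     (\<forall>y\<in>elts x. \<exists>g\<in>A. enumerates w g y) \<and> \<not> (\<exists>g\<in>A. enumerates w g x)"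

lemma definable_is_succ:
  assumes "closed A"
  shows "definable A (\<lambda>e. is_succ (e i) (e j))"
  unfolding is_succ_def
  by (intro definable_intros; rule definable_ball[OF assms, where n = "i+j+1"], simp,
      intro definable_intros)

lemma definable_is_omega:
  assumes "closed A"
  shows "definable A (\<lambda>e. is_omega (e i))"
  unfolding is_omega_def
  by (intro definable_intros,
      rule definable_bex[OF assms, where n = "i+1"], simp,
      rule definable_ball[OF assms, where n = "i+2"], simp, rule definable_False,
      rule definable_ball[OF assms, where n = "i+1"], simp,
      rule definable_bex[OF assms, where n = "i+2"], simp, rule definable_is_succ[OF assms],
      rule definable_ball[OF assms, where n = "i+1"], simp, intro definable_intros,
      rule definable_ball[OF assms, where n = "i+2"], simp, rule definable_False,
      rule definable_bex[OF assms, where n = "i+2"], simp, rule definable_is_succ[OF assms])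

lemma definable_enumerates:
  assumes "closed A"
  shows "definable A (\<lambda>e. enumerates (e i) (e j) (e k))"
  unfolding enumerates_def
  by (intro definable_intros,
      rule definable_ball[OF assms, where n = "i+j+k+1"], simp,
      rule definable_bex[OF assms, where n = "i+j+k+2"], simp, intro definable_intros assms,
      rule definable_ball[OF assms, where n = "i+j+k+1"], simp,
      rule definable_ball[OF assms, where n = "i+j+k+2"], simp,
      rule definable_ball[OF assms, where n = "i+j+k+3"], simp,
      intro definable_intros assms)

lemma definable_is_omega1:
  assumes "closed A"
  shows "definable A (\<lambda>e. is_omega1 A (e i) (e j))"
  unfolding is_omega1_def
  by (intro definable_intros,
      rule definable_ball[OF assms, where n = "i+j+1"], simp,
      rule definable_ball[OF assms, where n = "i+j+2"], simp, intro definable_intros,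
      rule definable_ball[OF assms, where n = "i+j+1"], simp,
      rule definable_ball[OF assms, where n = "i+j+2"], simp,
      rule definable_ball[OF assms, where n = "i+j+3"], simp, intro definable_intros,
      rule definable_ball[OF assms, where n = "i+j+1"], simp,
      rule definable_ex[where n = "i+j+2"], simp, rule definable_enumerates[OF assms],
      rule definable_ex[where n = "i+j+2"], simp, rule definable_enumerates[OF assms])

lemma is_succ_iff: "is_succ y x \<longleftrightarrow> elts y = insert x (elts x)"
  unfolding is_succ_def by blast

lemma is_succ_vnat: "is_succ x (vnat n) \<longleftrightarrow> x = vnat (Suc n)"
proof -
  have "elts (vnat (Suc n)) = insert (vnat n) (elts (vnat n))"
    unfolding elts_vnat lessThan_Suc by simp
  then show ?thesis unfolding is_succ_iff using extensionality by metis
qed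

lemma is_omega_iff: "is_omega (w::'v::zfc_universe) \<longleftrightarrow> w = aleph 0"
proof
  have v0: "z = vnat 0" if "elts z = {}" for z :: 'v
    using that by (intro extensionality) simp
  assume w: "is_omega w"
  then obtain z where z: "z \<in> elts w" "elts z = {}" unfolding is_omega_def by blast
  have 1: "vnat n \<in> elts w" for n
  proof (induct n)
    case 0
    show ?case using z v0 by metis
  next
    case (Suc n)
    then show ?case using w is_succ_vnat unfolding is_omega_def by metis
  qed
  have 2: "x \<in> range vnat" if "x \<in> elts w" for x
    using that
  proof (induct x rule: mem_induct)
    case (mem x)
    show ?case
    proof (cases "elts x = {}")
      case True
      then show ?thesis using v0 by blast
    next
      case False
      then obtain y where y: "y \<in> elts w" "is_succ x y"
        using w mem(2) unfolding is_omega_def by blast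
      then have "y \<in> elts x" unfolding is_succ_def by blast
      then obtain n where "y = vnat n" using mem(1) y(1) by blast
      then show ?thesis using y(2) is_succ_vnat by blast
    qed
  qed
  show "w = aleph 0"
    by (rule extensionality) (use 1 2 in \<open>auto simp only: elts_aleph_0\<close>)
next
  show "is_omega w" if "w = aleph 0"
    unfolding is_omega_def that elts_aleph_0
  proof (intro conjI ballI)
    show "\<exists>z\<in>range vnat. \<forall>y\<in>elts (z::'v). False" by (intro bexI[of _ "vnat 0"]) auto
    show "\<exists>y\<in>range vnat. is_succ y x" if "x \<in> range vnat" for x :: 'v
      using that is_succ_vnat by blast
    show "(\<forall>y\<in>elts x. False) \<or> (\<exists>y\<in>range vnat. is_succ x y)" if x: "x \<in> range vnat" for x :: 'v
    proof -
      obtain n where n: "x = vnat n" using x by blast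
      show ?thesis
      proof (cases n)
        case 0
        then show ?thesis using n by simp
      next
        case (Suc m)
        then show ?thesis using n is_succ_vnat by blast
      qed
    qed
  qed
qed

lemma enumerates_countable:
  assumes "enumerates (aleph 0) g x"
  shows "countable (elts x)"
proof -
  have "elts x \<subseteq> (\<lambda>n. THE y. y \<in> elts x \<and> vpair n y \<in> elts g) ` elts (aleph 0)"
  proof
    fix y assume y: "y \<in> elts x"
    then obtain n where n: "n \<in> elts (aleph 0)" "vpair n y \<in> elts g"
      using assms unfolding enumerates_def by blast
    have "(THE y. y \<in> elts x \<and> vpair n y \<in> elts g) = y"
    proof (rule the_equality)
      show "y \<in> elts x \<and> vpair n y \<in> elts g" using y n(2) by simp
      show "z = y" if "z \<in> elts x \<and> vpair n z \<in> elts g" for z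
        using assms that n y unfolding enumerates_def by simp
    qed
    from this[symmetric] n(1) show "y \<in> (\<lambda>n. THE y. y \<in> elts x \<and> vpair n y \<in> elts g) ` elts (aleph 0)"
      by (rule image_eqI)
  qed
  then show ?thesis
    by (rule countable_subset) (simp only: elts_aleph_0, simp)
qed

lemma vset_H:
  assumes "closed X" "X \<prec> elts \<theta>" "S \<subseteq> X"
  shows "vset S \<in> H \<theta>" "elts (vset S) = S"
proof -
  have "small S"
    using assms(2,3) by (meson lesspoll_imp_lepoll small_lepoll small_subset)
  then show "elts (vset S) = S" by (rule elts_vset_small)
  then show "vset S \<in> H \<theta>" using H_memI[OF assms(1,2)] assms(3) by simp
qed

lemma closed_Un: "closed X \<Longrightarrow> closed Y \<Longrightarrow> closed (X \<union> Y)"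
  unfolding closed_def by blast

lemma TC_lesspoll: "x \<in> H \<theta> \<Longrightarrow> TC x \<prec> elts \<theta>"
  unfolding H_def by simp

locale elementary_submodel =
  fixes \<theta> N :: "'v::zfc_universe"
  assumes infinite_theta: "infinite (elts \<theta>)"
    and omega1_H: "omega1 \<in> H \<theta>"
    and elementary: "elementary (elts N) (H \<theta>)"
begin

lemma N_H: "x \<in> elts N \<Longrightarrow> x \<in> H \<theta>"
  using elementary unfolding elementary_def by blast

lemma reflect:
  assumes "definable (H \<theta>) (\<lambda>e. Q (e 0) (e 1) (e 2) (e 3) (e 4) (e 5) (e 6))"
    and "a1 \<in> elts N" "a2 \<in> elts N" "a3 \<in> elts N" "a4 \<in> elts N" "a5 \<in> elts N" "a6 \<in> elts N"
    and "x \<in> H \<theta>" "Q x a1 a2 a3 a4 a5 a6"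
  shows "\<exists>x\<in>elts N. Q x a1 a2 a3 a4 a5 a6"
  by (rule elementary_reflect[OF elementary assms])

lemma omega_H: "aleph 0 \<in> H \<theta>"
proof -
  have "aleph 0 \<in> elts omega1"
    unfolding elts_omega1 mem_Collect_eq
    by (intro conjI Ord_aleph_0) (simp only: elts_aleph_0, simp)
  then show ?thesis using closedD[OF closed_H omega1_H] by blast
qed

lemma vnat_H: "vnat n \<in> H \<theta>"
  using closedD[OF closed_H omega_H] unfolding elts_aleph_0 by blast

lemma omega_N: "aleph 0 \<in> elts N"
proof -
  obtain a where "a \<in> elts N" using elementary unfolding elementary_def by blast
  then have "\<exists>x\<in>elts N. is_omega x"
    by (intro reflect[where Q = "\<lambda>x _ _ _ _ _ _. is_omega x" and x = "aleph 0", of a a a a a a]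
        definable_is_omega closed_H omega_H)
      (auto simp only: is_omega_iff)
  then show ?thesis unfolding is_omega_iff by blast
qed

text \<open>An enumeration is a set of pairs over the transitive closures of \<open>x\<close> and
  omega, hence hereditarily small enough.\<close>

lemma enumerates_H:
  assumes "x \<in> H \<theta>" "countable (elts x)"
  shows "\<exists>g\<in>H \<theta>. enumerates (aleph 0) g x"
proof -
  define X where "X = TC x \<union> TC (aleph 0 :: 'v)"
  have X: "closed X" "X \<prec> elts \<theta>"
    unfolding X_def using closed_Un closed_TC Un_lesspoll_infinite infinite_theta TC_lesspoll assms(1) omega_H
    by blast+
  define S where "S = {vpair (vnat (to_nat_on (elts x) y)) y |y. y \<in> elts x}"
  have vX: "vnat n \<in> X" "y \<in> elts x \<Longrightarrow> y \<in> X" for n y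
    unfolding X_def using elts_TC[of x] elts_TC[of "aleph 0 :: 'v"] unfolding elts_aleph_0 by blast+
  then have "S \<subseteq> pairs X" unfolding S_def using vpair_pairs by blast
  note S = vset_H[OF closed_pairs_closed[OF X(1)] pairs_lesspoll[OF infinite_theta X(2)] this]
  have "enumerates (aleph 0) (vset S) x"
    unfolding enumerates_def S(2) elts_aleph_0
  proof (intro conjI ballI impI; (elim conjE)?)
    show "\<exists>n\<in>range vnat. vpair n y \<in> S" if "y \<in> elts x" for y
      using that unfolding S_def by blast
    show "y = y'" if "y \<in> elts x" "y' \<in> elts x" "vpair n y \<in> S" "vpair n y' \<in> S" for n y y'
      using that assms(2) unfolding S_def by (auto simp: vnat_inject)
  qed
  then show ?thesis using S(1) by blast
qed

text \<open>\<open>N\<close> contains an enumeration of \<open>x\<close> and all natural numbers,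
  and the values of the enumeration are definable from these. Applied to \<open>M\<close>, this
  gives \<open>M \<subseteq> N\<close>.\<close>

lemma countable_subset_N:
  assumes x: "x \<in> elts N" "countable (elts x)"
  shows "elts x \<subseteq> elts N"
proof
  fix y assume y: "y \<in> elts x"
  obtain g0 where g0: "g0 \<in> H \<theta>" "enumerates (aleph 0) g0 x"
    using enumerates_H[OF N_H[OF x(1)] x(2)] by blast
  have "\<exists>g\<in>elts N. enumerates (aleph 0) g x"
    by (rule reflect[where Q = "\<lambda>g w x _ _ _ _. enumerates w g x" and ?a1.0 = "aleph 0" and
          ?a2.0 = x and ?a3.0 = x and ?a4.0 = x and ?a5.0 = x and ?a6.0 = x, OF _ _ _ _ _ _ _ g0])
      (simp_all only: definable_enumerates[OF closed_H] omega_N x(1))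
  then obtain g where g: "g \<in> elts N" "enumerates (aleph 0) g x" by blast
  then obtain n where n: "n \<in> elts (aleph 0)" "vpair n y \<in> elts g"
    using y unfolding enumerates_def by blast
  have vn: "vnat k \<in> elts N" for k
  proof (induct k)
    case 0
    have "\<exists>z\<in>elts N. \<forall>y\<in>elts z. False"
      by (rule reflect[where Q = "\<lambda>z _ _ _ _ _ _. \<forall>y\<in>elts z. False" and ?a1.0 = x and x = "vnat 0" and
            ?a2.0 = x and ?a3.0 = x and ?a4.0 = x and ?a5.0 = x and ?a6.0 = x],
          rule definable_ball[OF closed_H, where n = 7], simp, rule definable_False)
        (simp_all add: x(1) vnat_H)
    then obtain z where z: "z \<in> elts N" "elts z = {}" by blast
    have "z = vnat 0" by (rule extensionality) (simp add: z)
    then show ?case using z(1) by simp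
  next
    case (Suc k)
    have "\<exists>z\<in>elts N. is_succ z (vnat k)"
      by (rule reflect[where Q = "\<lambda>z y _ _ _ _ _. is_succ z y" and ?a1.0 = "vnat k" and x = "vnat (Suc k)" and
            ?a2.0 = x and ?a3.0 = x and ?a4.0 = x and ?a5.0 = x and ?a6.0 = x],
          rule definable_is_succ[OF closed_H])
        (simp_all add: x(1) vnat_H Suc is_succ_vnat)
    then show ?case unfolding is_succ_vnat by blast
  qed
  then have "n \<in> elts N" using n(1) unfolding elts_aleph_0 by blast
  have "\<exists>y\<in>elts N. y \<in> elts x \<and> vpair n y \<in> elts g"
    by (rule reflect[where Q = "\<lambda>y g n x _ _ _. y \<in> elts x \<and> vpair n y \<in> elts g" and
          ?a1.0 = g and ?a2.0 = n and ?a3.0 = x and ?a4.0 = x and ?a5.0 = x and ?a6.0 = x and x = y],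
        intro definable_intros closed_H)
      (use x(1) g(1) \<open>n \<in> elts N\<close> y n(2) closedD[OF closed_H N_H[OF x(1)]] in auto)
  then obtain y' where "y' \<in> elts N" "y' \<in> elts x" "vpair n y' \<in> elts g" by blast
  moreover from this have "y' = y" using g(2) n y unfolding enumerates_def by blast
  ultimately show "y \<in> elts N" by simp
qed

lemma is_omega1_iff:
  assumes "x \<in> H \<theta>"
  shows "is_omega1 (H \<theta>) (aleph 0) x \<longleftrightarrow> x = omega1"
proof -
  have en: "(\<exists>g\<in>H \<theta>. enumerates (aleph 0) g y) \<longleftrightarrow> countable (elts y)" if "y \<in> H \<theta>" for y
    using enumerates_H[OF that] enumerates_countable by blast
  have yH: "y \<in> H \<theta>" if "y \<in> elts x" for y using closedD[OF closed_H assms that] .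
  have c: "(\<forall>y\<in>elts x. \<exists>g\<in>H \<theta>. enumerates (aleph 0) g y) \<longleftrightarrow> (\<forall>y\<in>elts x. countable (elts y))"
    by (rule ball_cong[OF refl]) (simp only: en yH)
  have "is_omega1 (H \<theta>) (aleph 0) x \<longleftrightarrow>
      Ord x \<and> (\<forall>y\<in>elts x. countable (elts y)) \<and> uncountable (elts x)"
    unfolding is_omega1_def Ord_def transitive_set_def c en[OF assms] subset_eq
    by (simp only: conj_assoc)
  also have "\<dots> \<longleftrightarrow> x = omega1"
  proof
    show "x = omega1" if "Ord x \<and> (\<forall>y\<in>elts x. countable (elts y)) \<and> uncountable (elts x)"
      by (rule omega1_unique) (use that in auto)
    show "Ord x \<and> (\<forall>y\<in>elts x. countable (elts y)) \<and> uncountable (elts x)" if "x = omega1"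
      unfolding that using Ord_omega1 uncountable_omega1 by (auto simp: elts_omega1)
  qed
  finally show ?thesis .
qed

lemma omega1_N: "omega1 \<in> elts N"
proof -
  have "\<exists>x\<in>elts N. is_omega1 (H \<theta>) (aleph 0) x"
    by (rule reflect[where Q = "\<lambda>x w _ _ _ _ _. is_omega1 (H \<theta>) w x" and x = omega1 and ?a1.0 = "aleph 0"
          and ?a2.0 = "aleph 0" and ?a3.0 = "aleph 0" and ?a4.0 = "aleph 0" and ?a5.0 = "aleph 0"
          and ?a6.0 = "aleph 0"])
      (simp_all only: definable_is_omega1[OF closed_H] omega_N omega1_H is_omega1_iff)
  then show ?thesis using is_omega1_iff N_H by blast
qed

text \<open>Countable ordinals in \<open>N\<close> are subsets of \<open>N\<close>, so the
  intersection is transitive.\<close>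

lemma omega1_Int_N: "vset (elts omega1 \<inter> elts N) \<in> elts omega1"
  if "countable (elts N)"
proof -
  have c: "countable (elts omega1 \<inter> elts N)" using that by blast
  note e = elts_vset_small[OF small_countable[OF c]]
  have "Ord (vset (elts omega1 \<inter> elts N))"
  proof (rule Ord_vset[OF small_countable[OF c]])
    fix x assume x: "x \<in> elts omega1 \<inter> elts N"
    then have "Ord x" "countable (elts x)" by (auto simp: elts_omega1)
    then show "Ord x \<and> elts x \<subseteq> elts omega1 \<inter> elts N"
      using x countable_subset_N Ord_mem_subset[OF Ord_omega1] by blast
  qed
  then show ?thesis using c e by (simp add: elts_omega1)
qed

lemma vpair_N:
  assumes "vpair a b \<in> elts N"
  shows "a \<in> elts N" "b \<in> elts N"
proof -
  have ab: "a \<in> H \<theta>" "b \<in> H \<theta>" using vpair_mem_closed[OF closed_H N_H[OF assms]] by blast+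
  let ?p = "vpair a b"
  have "\<exists>x\<in>elts N. \<exists>y\<in>H \<theta>. ?p = vpair x y"
    by (rule reflect[where Q = "\<lambda>x p _ _ _ _ _. \<exists>y\<in>H \<theta>. p = vpair x y" and x = a and ?a1.0 = ?p
          and ?a2.0 = ?p and ?a3.0 = ?p and ?a4.0 = ?p and ?a5.0 = ?p and ?a6.0 = ?p],
        rule definable_ex[where n = 7], simp, intro definable_intros closed_H)
      (use assms ab in auto)
  then show "a \<in> elts N" by simp
  have "\<exists>y\<in>elts N. \<exists>x\<in>H \<theta>. ?p = vpair x y"
    by (rule reflect[where Q = "\<lambda>y p _ _ _ _ _. \<exists>x\<in>H \<theta>. p = vpair x y" and x = b and ?a1.0 = ?p
          and ?a2.0 = ?p and ?a3.0 = ?p and ?a4.0 = ?p and ?a5.0 = ?p and ?a6.0 = ?p],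
        rule definable_ex[where n = 7], simp, intro definable_intros closed_H)
      (use assms ab in auto)
  then show "b \<in> elts N" by simp
qed

end


subsection \<open>The forcing relation inside \<open>H\<close>\<close>

text \<open>
  The forcing relation is not itself a formula, so \<open>H \<theta>\<close> only sees it through set-sized fragments:
  \<open>E\<close> below is \<open>p \<Vdash> x = y\<close> restricted to a transitive set \<open>A\<close> of potential names, and \<open>c\<close> is the
  restriction of \<open>check\<close> to \<open>\<omega>\<^sub>1\<close>. \<open>eq_half\<close> is one of the two inclusions in the recursion for
  \<open>forces_eq\<close>, with \<open>forces_mem\<close> unfolded.
\<close>

definition eq_half ::
  "'v::zfc_universe \<Rightarrow> 'v \<Rightarrow> 'v \<Rightarrow> ('v \<Rightarrow> 'v \<Rightarrow> 'v \<Rightarrow> bool) \<Rightarrow> 'v \<Rightarrow> 'v \<Rightarrow> 'v \<Rightarrow> bool" where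
  "eq_half C R A X p x y \<longleftrightarrow> (\<forall>\<sigma>\<in>elts A. \<forall>s\<in>elts C. vpair \<sigma> s \<in> elts x \<longrightarrow>
     (\<forall>q\<in>elts C. vpair q p \<in> elts R \<and> vpair q s \<in> elts R \<longrightarrow>
       (\<forall>q'\<in>elts C. vpair q' q \<in> elts R \<longrightarrow>
         (\<exists>r\<in>elts C. \<exists>\<rho>\<in>elts A. \<exists>u\<in>elts C. vpair \<rho> u \<in> elts y \<and>
            vpair r q' \<in> elts R \<and> vpair r u \<in> elts R \<and> X r \<sigma> \<rho>))))"

definition is_eq_rel :: "'v::zfc_universe \<Rightarrow> 'v \<Rightarrow> 'v \<Rightarrow> 'v \<Rightarrow> bool" where
  "is_eq_rel E A C R \<longleftrightarrow> (\<forall>p\<in>elts C. \<forall>x\<in>elts A. \<forall>y\<in>elts A. vpair p (vpair x y) \<in> elts E \<longleftrightarrow>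
     eq_half C R A (\<lambda>r \<sigma> \<rho>. vpair r (vpair \<sigma> \<rho>) \<in> elts E) p x y \<and>
     eq_half C R A (\<lambda>r \<sigma> \<rho>. vpair r (vpair \<sigma> \<rho>) \<in> elts E) p y x)"

definition is_check_fun :: "'v::zfc_universe set \<Rightarrow> 'v \<Rightarrow> 'v \<Rightarrow> 'v \<Rightarrow> bool" where
  "is_check_fun B c w C \<longleftrightarrow> (\<forall>\<gamma>\<in>elts w. \<exists>y\<in>B. vpair \<gamma> y \<in> elts c) \<and>
     (\<forall>\<gamma>\<in>elts w. \<forall>y\<in>B. vpair \<gamma> y \<in> elts c \<longrightarrow>
        (\<forall>z\<in>elts y. \<exists>\<beta>\<in>elts \<gamma>. \<exists>p\<in>elts C. \<exists>b\<in>B. vpair \<beta> b \<in> elts c \<and> z = vpair b p) \<and>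
        (\<forall>\<beta>\<in>elts \<gamma>. \<forall>p\<in>elts C. \<forall>b\<in>B. vpair \<beta> b \<in> elts c \<longrightarrow> vpair b p \<in> elts y))"

text \<open>The recursion for forced equality descends into names, so its domain \<open>A\<close> is
  transitive; it contains the names to be compared, those in \<open>M\<close> and the values of
  \<open>c\<close>.\<close>

definition is_name_dom :: "'v::zfc_universe set \<Rightarrow> 'v \<Rightarrow> 'v \<Rightarrow> 'v \<Rightarrow> 'v \<Rightarrow> bool" where
  "is_name_dom B A M w c \<longleftrightarrow> (\<forall>x\<in>elts A. \<forall>y\<in>elts x. y \<in> elts A) \<and> (\<forall>x\<in>elts M. x \<in> elts A) \<and>
     (\<forall>\<gamma>\<in>elts w. \<forall>y\<in>B. vpair \<gamma> y \<in> elts c \<longrightarrow> y \<in> elts A)"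

text \<open>The formula to be reflected: some \<open>T\<close> below \<open>q\<close> rules out all
  values in \<open>w\<close> above \<open>\<delta>\<close> for the elements of \<open>M\<close>,
  with check names and forced equality read off \<open>c\<close> and \<open>E\<close>.\<close>

definition is_bound :: "'v::zfc_universe set \<Rightarrow> 'v \<Rightarrow> 'v \<Rightarrow> 'v \<Rightarrow> 'v \<Rightarrow> 'v \<Rightarrow> 'v \<Rightarrow> 'v \<Rightarrow> bool" where
  "is_bound B \<delta> w R q M c E \<longleftrightarrow> \<delta> \<in> elts w \<and> (\<exists>T\<in>B. vpair T q \<in> elts R \<and>
     (\<forall>\<tau>\<in>elts M. \<forall>\<gamma>\<in>elts w. \<delta> \<in> elts \<gamma> \<longrightarrow> (\<forall>y\<in>B. vpair \<gamma> y \<in> elts c \<longrightarrow>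
        \<not> (\<exists>r\<in>B. vpair r T \<in> elts R \<and> vpair r (vpair \<tau> y) \<in> elts E))))"

text \<open>Variables 0 to 3 are \<open>E\<close>, \<open>A\<close>, \<open>C\<close>,
  \<open>R\<close>, and 7 to 9 are bound in \<open>is_eq_rel\<close>. The places \<open>k\<close>
  and \<open>l\<close> vary because both inclusions are needed.\<close>

lemma definable_eq_half:
  assumes "closed B" "k < 10" "l < 10"
  shows "definable B (\<lambda>e. eq_half (e 2) (e 3) (e 1) (\<lambda>r \<sigma> \<rho>. vpair r (vpair \<sigma> \<rho>) \<in> elts (e 0)) (e 7) (e k) (e l))"
  unfolding eq_half_def
  by (rule definable_ball[OF assms(1), where n = 10], use assms in simp,
      rule definable_ball[OF assms(1), where n = 11], use assms in simp,
      intro definable_intros assms(1),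
      rule definable_ball[OF assms(1), where n = 12], use assms in simp,
      intro definable_intros assms(1),
      rule definable_ball[OF assms(1), where n = 13], use assms in simp,
      intro definable_intros assms(1),
      rule definable_bex[OF assms(1), where n = 14], use assms in simp,
      rule definable_bex[OF assms(1), where n = 15], use assms in simp,
      rule definable_bex[OF assms(1), where n = 16], use assms in simp,
      intro definable_intros assms(1))

lemma definable_is_eq_rel:
  assumes "closed B"
  shows "definable B (\<lambda>e. is_eq_rel (e 0) (e 1) (e 2) (e 3))"
  unfolding is_eq_rel_def
  by (rule definable_ball[OF assms, where n = 7], simp add: eq_half_def,
      rule definable_ball[OF assms, where n = 8], simp add: eq_half_def,
      rule definable_ball[OF assms, where n = 9], simp add: eq_half_def,
      intro definable_iff definable_conj definable_triple_mem definable_eq_half assms; simp)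

lemma definable_is_check_fun:
  assumes "closed B"
  shows "definable B (\<lambda>e. is_check_fun B (e 0) (e 1) (e 2))"
  unfolding is_check_fun_def
  by (rule definable_conj,
      rule definable_ball[OF assms, where n = 7], simp,
      rule definable_ex[where n = 8], simp, intro definable_intros assms,
      rule definable_ball[OF assms, where n = 7], simp,
      rule definable_all[where n = 8], simp, intro definable_intros assms,
      rule definable_ball[OF assms, where n = 9], simp,
      rule definable_bex[OF assms, where n = 10], simp,
      rule definable_bex[OF assms, where n = 11], simp,
      rule definable_ex[where n = 12], simp, intro definable_intros assms,
      rule definable_ball[OF assms, where n = 9], simp,
      rule definable_ball[OF assms, where n = 10], simp,
      rule definable_all[where n = 11], simp, intro definable_intros assms)

lemma definable_is_name_dom:
  assumes "closed B"
  shows "definable B (\<lambda>e. is_name_dom B (e 0) (e 1) (e 2) (e 3))"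
  unfolding is_name_dom_def
  by (intro definable_conj,
      rule definable_ball[OF assms, where n = 7], simp,
      rule definable_ball[OF assms, where n = 8], simp, intro definable_intros assms,
      rule definable_ball[OF assms, where n = 7], simp, intro definable_intros assms,
      rule definable_ball[OF assms, where n = 7], simp,
      rule definable_all[where n = 8], simp, intro definable_intros assms)

lemma definable_is_bound:
  assumes "closed B"
  shows "definable B (\<lambda>e. is_bound B (e 0) (e 1) (e 2) (e 3) (e 4) (e 5) (e 6))"
  unfolding is_bound_def
  by (intro definable_intros,
      rule definable_ex[where n = 7], simp, intro definable_intros assms,
      rule definable_ball[OF assms, where n = 8], simp,
      rule definable_ball[OF assms, where n = 9], simp, intro definable_intros,
      rule definable_all[where n = 10], simp, intro definable_intros assms,
      rule definable_ex[where n = 11], simp, intro definable_intros assms)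

text \<open>A transitive \<open>A\<close> contains the components of its names, and the order
  relates only conditions, so restricting the quantifiers to \<open>A\<close> and \<open>C\<close>
  changes nothing.\<close>

lemma forces_eq_half:
  assumes leq: "\<And>q p. leq P q p \<longleftrightarrow> vpair q p \<in> elts R"
    and R: "\<And>q p. vpair q p \<in> elts R \<Longrightarrow> q \<in> elts C \<and> p \<in> elts C"
    and A: "closed (elts A)" "x \<in> elts A" "y \<in> elts A"
  shows "forces_eq P p x y \<longleftrightarrow>
    eq_half C R A (forces_eq P) p x y \<and> eq_half C R A (forces_eq P) p y x"
proof -
  have dom: "\<sigma> \<in> elts A" if "vpair \<sigma> s \<in> elts z" "z \<in> elts A" for \<sigma> s z
    using vpair_mem_closed(1)[OF A(1) closedD[OF A(1) that(2,1)]] .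
  have half: "(\<forall>\<sigma> s. vpair \<sigma> s \<in> elts a \<longrightarrow> (\<forall>q. leq P q p \<and> leq P q s \<longrightarrow> forces_mem P q \<sigma> b)) \<longleftrightarrow>
      eq_half C R A (forces_eq P) p a b" if ab: "a \<in> elts A" "b \<in> elts A" for a b
  proof -
    have mem: "forces_mem P q \<sigma> b \<longleftrightarrow> (\<forall>q'\<in>elts C. vpair q' q \<in> elts R \<longrightarrow>
         (\<exists>r\<in>elts C. \<exists>\<rho>\<in>elts A. \<exists>u\<in>elts C. vpair \<rho> u \<in> elts b \<and>
            vpair r q' \<in> elts R \<and> vpair r u \<in> elts R \<and> forces_eq P r \<sigma> \<rho>))" for q \<sigma>
      unfolding forces_mem.simps[of P q \<sigma> b] leq using R dom[OF _ ab(2)] by meson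
    show ?thesis
      unfolding eq_half_def mem[symmetric] leq using R dom[OF _ ab(1)] by meson
  qed
  show ?thesis
    unfolding forces_eq.simps[of P p x y] half[OF A(2,3)] half[OF A(3,2)] ..
qed

lemma eq_half_cong:
  assumes "\<And>r \<sigma> s \<rho> u. r \<in> elts C \<Longrightarrow> vpair \<sigma> s \<in> elts a \<Longrightarrow> vpair \<rho> u \<in> elts b \<Longrightarrow>
    \<sigma> \<in> elts A \<Longrightarrow> \<rho> \<in> elts A \<Longrightarrow> X r \<sigma> \<rho> \<longleftrightarrow> Y r \<sigma> \<rho>"
  shows "eq_half C R A X p a b \<longleftrightarrow> eq_half C R A Y p a b"
  unfolding eq_half_def
  by (intro ball_cong bex_cong refl imp_cong conj_cong) (use assms in blast)

text \<open>The recursion has one solution on \<open>A\<close>. Both orders of \<open>x\<close> and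
  \<open>y\<close> go through the induction together, as the inclusion of \<open>y\<close> in
  \<open>x\<close> refers to pairs whose second member comes from \<open>x\<close>.\<close>

lemma is_eq_rel_forces_eq:
  assumes leq: "\<And>q p. leq P q p \<longleftrightarrow> vpair q p \<in> elts R"
    and R: "\<And>q p. vpair q p \<in> elts R \<Longrightarrow> q \<in> elts C \<and> p \<in> elts C"
    and A: "closed (elts A)" and E: "is_eq_rel E A C R"
    and x: "x \<in> elts A" "y \<in> elts A" "p \<in> elts C"
  shows "vpair p (vpair x y) \<in> elts E \<longleftrightarrow> forces_eq P p x y"
proof -
  let ?E = "\<lambda>r \<sigma> \<rho>. vpair r (vpair \<sigma> \<rho>) \<in> elts E"
  have "\<forall>y\<in>elts A. \<forall>p\<in>elts C. (?E p x y \<longleftrightarrow> forces_eq P p x y) \<and> (?E p y x \<longleftrightarrow> forces_eq P p y x)"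
    using x(1)
  proof (induct x rule: wf_induct_rule[OF wf_trancl[OF wf_memrel]])
    case (1 x)
    have IH: "(?E r \<sigma> \<rho> \<longleftrightarrow> forces_eq P r \<sigma> \<rho>) \<and> (?E r \<rho> \<sigma> \<longleftrightarrow> forces_eq P r \<rho> \<sigma>)"
      if "vpair \<sigma> s \<in> elts x" "\<sigma> \<in> elts A" "\<rho> \<in> elts A" "r \<in> elts C" for \<sigma> s \<rho> r
      using 1(1)[OF vpair_fst_memrel[OF that(1)] that(2)] that(3,4) by blast
    show ?case
    proof (intro ballI)
      fix y p assume y: "y \<in> elts A" "p \<in> elts C"
      have h: "eq_half C R A ?E p x y \<longleftrightarrow> eq_half C R A (forces_eq P) p x y"
        "eq_half C R A ?E p y x \<longleftrightarrow> eq_half C R A (forces_eq P) p y x"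
        by (rule eq_half_cong; use IH in blast)+
      have "?E p a b \<longleftrightarrow> eq_half C R A ?E p a b \<and> eq_half C R A ?E p b a"
        if "a \<in> elts A" "b \<in> elts A" for a b
        using E y(2) that unfolding is_eq_rel_def by blast
      then show "(?E p x y \<longleftrightarrow> forces_eq P p x y) \<and> (?E p y x \<longleftrightarrow> forces_eq P p y x)"
        using h forces_eq_half[OF leq R A 1(2) y(1), of p] forces_eq_half[OF leq R A y(1) 1(2), of p]
          1(2) y(1) by blast
    qed
  qed
  then show ?thesis using x by blast
qed

text \<open>\<open>is_check_fun\<close> states the recursion of \<open>check\<close> for a relation
  \<open>c\<close>; that \<open>c\<close> is single-valued follows by induction on
  \<open>\<gamma>\<close>.\<close>

lemma is_check_fun_eq:
  assumes B: "closed B" and C: "conds P = elts C" and c: "is_check_fun B c w C"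
    and w: "closed (elts w)"
  shows "\<gamma> \<in> elts w \<Longrightarrow> \<gamma> \<in> B \<Longrightarrow> y \<in> B \<Longrightarrow> vpair \<gamma> y \<in> elts c \<Longrightarrow> y = check P \<gamma>"
proof (induct \<gamma> arbitrary: y rule: mem_induct)
  case (mem \<gamma>)
  have IH: "b = check P \<beta>" if "\<beta> \<in> elts \<gamma>" "b \<in> B" "vpair \<beta> b \<in> elts c" for \<beta> b
    using mem(1)[OF that(1) closedD[OF w mem(2) that(1)] closedD[OF B mem(3) that(1)] that(2,3)] .
  have tot: "\<exists>b\<in>B. vpair \<beta> b \<in> elts c" if "\<beta> \<in> elts \<gamma>" for \<beta>
    using c closedD[OF w mem(2) that] unfolding is_check_fun_def by blast
  have cl: "\<forall>z\<in>elts y. \<exists>\<beta>\<in>elts \<gamma>. \<exists>p\<in>elts C. \<exists>b\<in>B. vpair \<beta> b \<in> elts c \<and> z = vpair b p"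
    "\<forall>\<beta>\<in>elts \<gamma>. \<forall>p\<in>elts C. \<forall>b\<in>B. vpair \<beta> b \<in> elts c \<longrightarrow> vpair b p \<in> elts y"
    using c mem(2,4,5) unfolding is_check_fun_def by blast+
  show ?case
  proof (rule extensionality, intro equalityI subsetI)
    fix z assume z: "z \<in> elts y"
    then obtain \<beta> p b where "\<beta> \<in> elts \<gamma>" "p \<in> elts C" "b \<in> B" "vpair \<beta> b \<in> elts c" "z = vpair b p"
      using cl(1) by blast
    then show "z \<in> elts (check P \<gamma>)" using IH by (auto simp: elts_check C)
  next
    fix z assume "z \<in> elts (check P \<gamma>)"
    then obtain \<beta> p where z: "\<beta> \<in> elts \<gamma>" "p \<in> elts C" "z = vpair (check P \<beta>) p"
      by (auto simp: elts_check C)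
    then obtain b where b: "b \<in> B" "vpair \<beta> b \<in> elts c" using tot by blast
    then have "b = check P \<beta>" using IH z(1) by blast
    then show "z \<in> elts y" using cl(2) z b by blast
  qed
qed

section \<open>Finding the fragments and the bound in N\<close>

context elementary_submodel
begin

lemma mem_closed_H: "closed X \<Longrightarrow> X \<prec> elts \<theta> \<Longrightarrow> x \<in> X \<Longrightarrow> x \<in> H \<theta>"
  using H_memI closed_def by metis

text \<open>The true restriction of \<open>check\<close> is a set of pairs over \<open>U\<close>,
  hence in \<open>H \<theta>\<close>; elementarity then yields a solution of the same recursion in
  \<open>N\<close>.\<close>

lemma check_fun_N:
  assumes P: "P = vpair C R" and C: "C \<in> elts N" and U: "closed U" "U \<prec> elts \<theta>"
    and U_sub: "elts omega1 \<subseteq> U" "check P ` elts omega1 \<subseteq> U"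
  shows "\<exists>c\<in>elts N. is_check_fun (H \<theta>) c omega1 C"
proof -
  define S where "S = {vpair \<gamma> (check P \<gamma>) |\<gamma>. \<gamma> \<in> elts omega1}"
  have "S \<subseteq> pairs U"
  proof
    fix z assume "z \<in> S"
    then obtain \<gamma> where \<gamma>: "\<gamma> \<in> elts omega1" "z = vpair \<gamma> (check P \<gamma>)" unfolding S_def by blast
    have "\<gamma> \<in> U" "check P \<gamma> \<in> U" using U_sub \<gamma>(1) by blast+
    then show "z \<in> pairs U" unfolding \<gamma>(2) by (rule vpair_pairs)
  qed
  note S = vset_H[OF closed_pairs_closed[OF U(1)] pairs_lesspoll[OF infinite_theta U(2)] this]
  have chH: "check P \<gamma> \<in> H \<theta>" if "\<gamma> \<in> elts omega1" for \<gamma>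
    using mem_closed_H[OF U] U_sub that by blast
  have mS: "vpair \<gamma> y \<in> S \<longleftrightarrow> \<gamma> \<in> elts omega1 \<and> y = check P \<gamma>" for \<gamma> y
    unfolding S_def by auto
  have sub: "\<beta> \<in> elts omega1" if "\<beta> \<in> elts \<gamma>" "\<gamma> \<in> elts omega1" for \<beta> \<gamma> :: 'v
    using Ord_mem_subset[OF Ord_omega1] that by blast
  have "is_check_fun (H \<theta>) (vset S) omega1 C"
    unfolding is_check_fun_def S(2)
  proof (intro conjI ballI impI)
    show "\<exists>y\<in>H \<theta>. vpair \<gamma> y \<in> S" if "\<gamma> \<in> elts omega1" for \<gamma>
      using chH[OF that] that by (intro bexI[of _ "check P \<gamma>"]) (auto simp: mS)
  next
    fix \<gamma> y z assume h: "\<gamma> \<in> elts omega1" "vpair \<gamma> y \<in> S" "z \<in> elts y"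
    then obtain \<beta> p where \<beta>: "\<beta> \<in> elts \<gamma>" "p \<in> elts C" "z = vpair (check P \<beta>) p"
      by (auto simp: mS elts_check P conds_vpair)
    then show "\<exists>\<beta>\<in>elts \<gamma>. \<exists>p\<in>elts C. \<exists>b\<in>H \<theta>. vpair \<beta> b \<in> S \<and> z = vpair b p"
      using sub[OF _ h(1)] chH by (intro bexI[of _ \<beta>] bexI[of _ p] bexI[of _ "check P \<beta>"]) (auto simp: mS)
  next
    fix \<gamma> y \<beta> p b assume "\<gamma> \<in> elts omega1" "vpair \<gamma> y \<in> S" "\<beta> \<in> elts \<gamma>" "p \<in> elts C" "vpair \<beta> b \<in> S"
    then show "vpair b p \<in> elts y" by (auto simp: mS elts_check P conds_vpair)
  qed
  then show ?thesis
    by (intro reflect[where Q = "\<lambda>c w C _ _ _ _. is_check_fun (H \<theta>) c w C", OF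
          definable_is_check_fun[OF closed_H] omega1_N C C C C C S(1)])
qed

lemma eq_rel_N:
  assumes leq: "\<And>q p. leq P q p \<longleftrightarrow> vpair q p \<in> elts R"
    and R: "\<And>q p. vpair q p \<in> elts R \<Longrightarrow> q \<in> elts C \<and> p \<in> elts C"
    and N: "A \<in> elts N" "C \<in> elts N" "R \<in> elts N" and A: "closed (elts A)"
  shows "\<exists>E\<in>elts N. is_eq_rel E A C R"
proof -
  define X where "X = TC A \<union> TC C"
  have "X \<prec> elts \<theta>"
    unfolding X_def using N by (intro Un_lesspoll_infinite infinite_theta TC_lesspoll N_H)
  moreover have "closed X" unfolding X_def by (intro closed_Un closed_TC)
  \<comment> \<open>Triples are nested pairs, whence two rounds of \<open>pairs\<close>.\<close>
  ultimately have PX: "closed (pairs (pairs X))" "pairs (pairs X) \<prec> elts \<theta>"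
    using closed_pairs_closed pairs_lesspoll[OF infinite_theta] by blast+
  have sub: "elts A \<subseteq> X" "elts C \<subseteq> X" unfolding X_def using elts_TC by blast+
  define S where
    "S = {vpair p (vpair x y) |p x y. p \<in> elts C \<and> x \<in> elts A \<and> y \<in> elts A \<and> forces_eq P p x y}"
  have "S \<subseteq> pairs (pairs X)"
  proof
    fix z assume "z \<in> S"
    then obtain p x y where z: "z = vpair p (vpair x y)" "p \<in> X" "x \<in> X" "y \<in> X"
      using sub unfolding S_def by blast
    have "p \<in> pairs X" using z(2) subset_pairs by blast
    then show "z \<in> pairs (pairs X)" unfolding z(1) by (intro vpair_pairs z(3,4))
  qed
  note S = vset_H[OF PX this]
  have mS: "vpair p (vpair x y) \<in> S \<longleftrightarrow>
      p \<in> elts C \<and> x \<in> elts A \<and> y \<in> elts A \<and> forces_eq P p x y" for p x y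
    unfolding S_def by auto
  have "is_eq_rel (vset S) A C R"
    unfolding is_eq_rel_def S(2)
  proof (intro ballI)
    fix p x y assume h: "p \<in> elts C" "x \<in> elts A" "y \<in> elts A"
    have *: "eq_half C R A (\<lambda>r \<sigma> \<rho>. vpair r (vpair \<sigma> \<rho>) \<in> S) p a b \<longleftrightarrow>
        eq_half C R A (forces_eq P) p a b" for a b
      by (rule eq_half_cong) (simp add: mS)
    show "vpair p (vpair x y) \<in> S \<longleftrightarrow>
        eq_half C R A (\<lambda>r \<sigma> \<rho>. vpair r (vpair \<sigma> \<rho>) \<in> S) p x y \<and>
        eq_half C R A (\<lambda>r \<sigma> \<rho>. vpair r (vpair \<sigma> \<rho>) \<in> S) p y x"
      unfolding * using forces_eq_half[OF leq R A h(2,3)] h by (simp add: mS)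
  qed
  then show ?thesis
    by (intro reflect[where Q = "\<lambda>E A C R _ _ _. is_eq_rel E A C R", OF
          definable_is_eq_rel[OF closed_H] N N(1) N(1) N(1) S(1)])
qed

text \<open>Elementarity puts \<open>c\<close>, then \<open>A\<close>, then \<open>E\<close> into
  \<open>N\<close>. These may differ from the sets built in \<open>H \<theta>\<close>, but solutions
  of the recursions agree with the true \<open>check\<close> and forced equality, so what
  \<open>is_bound\<close> says with them is true.\<close>

lemma reflect_bound:
  assumes M: "M \<in> elts N" and P: "P = vpair C R" "P \<in> elts N"
    and R0: "elts R \<subseteq> {vpair q p |q p. q \<in> elts C \<and> p \<in> elts C}"
    and q: "q \<in> elts N" and \<delta>0: "\<delta>0 \<in> elts omega1" and T0: "leq P T0 q"
    and no: "\<And>\<tau> \<gamma> r. \<tau> \<in> elts M \<Longrightarrow> \<gamma> \<in> elts omega1 \<Longrightarrow> \<delta>0 \<in> elts \<gamma> \<Longrightarrow> leq P r T0 \<Longrightarrow>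
      \<not> forces_eq P r \<tau> (check P \<gamma>)"
  shows "\<exists>\<delta>\<in>elts omega1 \<inter> elts N. \<exists>T. leq P T q \<and> (\<forall>\<tau>\<in>elts M. \<forall>\<gamma>\<in>elts omega1. \<delta> \<in> elts \<gamma> \<longrightarrow>
    (\<forall>r. leq P r T \<longrightarrow> \<not> forces_eq P r \<tau> (check P \<gamma>)))"
proof -
  have R: "q \<in> elts C \<and> p \<in> elts C" if "vpair q p \<in> elts R" for q p using R0 that by auto
  have leq: "leq P q p \<longleftrightarrow> vpair q p \<in> elts R" for q p
    unfolding P(1) leq_vpair using R by blast
  have CR: "C \<in> elts N" "R \<in> elts N" using vpair_N P by blast+
  have C: "conds P = elts C" unfolding P(1) by (rule conds_vpair)
  have CH: "x \<in> H \<theta>" if "x \<in> elts C" for x using closedD[OF closed_H N_H[OF CR(1)] that] .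
  have w: "closed (elts (omega1 :: 'v))" using Ord_mem_subset[OF Ord_omega1] unfolding closed_def by blast
  \<comment> \<open>Check names have pairs as elements, so \<open>B\<close> itself need not be
    transitive, but \<open>pairs B\<close> is.\<close>
  define B where "B = (TC M \<union> TC C) \<union> (elts omega1 \<union> check P ` elts omega1)"
  have w_less: "elts (omega1 :: 'v) \<prec> elts \<theta>"
    by (rule lesspoll_trans1[OF subset_imp_lepoll[OF elts_TC] TC_lesspoll[OF omega1_H]])
  have "B \<prec> elts \<theta>"
    unfolding B_def
    by (intro Un_lesspoll_infinite infinite_theta TC_lesspoll N_H M CR(1) w_less
        lesspoll_trans1[OF image_lepoll w_less])
  then have U: "pairs B \<prec> elts \<theta>" by (rule pairs_lesspoll[OF infinite_theta])
  have cU: "closed (pairs B)"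
  proof (rule closed_pairs)
    fix x assume x: "x \<in> B"
    show "elts x \<subseteq> pairs B"
    proof (cases "x \<in> TC M \<union> TC C \<union> elts omega1")
      case True
      have "closed (TC M \<union> TC C \<union> elts omega1)" by (intro closed_Un closed_TC w)
      then have "elts x \<subseteq> B" using True unfolding closed_def B_def by blast
      then show ?thesis using subset_pairs by blast
    next
      case False
      then obtain \<gamma> where \<gamma>: "\<gamma> \<in> elts omega1" "x = check P \<gamma>" using x unfolding B_def by blast
      show ?thesis
      proof
        fix z assume "z \<in> elts x"
        then obtain \<beta> p where z: "\<beta> \<in> elts \<gamma>" "p \<in> elts C" "z = vpair (check P \<beta>) p"
          unfolding \<gamma>(2) by (auto simp: elts_check C)
        have "check P \<beta> \<in> B" "p \<in> B"
          using closedD[OF w \<gamma>(1) z(1)] z(2) elts_TC[of C] unfolding B_def by blast+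
        then show "z \<in> pairs B" unfolding z(3) by (rule vpair_pairs)
      qed
    qed
  qed
  have wB: "elts omega1 \<subseteq> pairs B" "check P ` elts omega1 \<subseteq> pairs B" "elts M \<subseteq> pairs B"
    using subset_pairs[of B] elts_TC[of M] unfolding B_def by blast+
  obtain c where c: "c \<in> elts N" "is_check_fun (H \<theta>) c omega1 C"
    using check_fun_N[OF P(1) CR(1) cU U wB(1,2)] by blast
  have wH: "\<gamma> \<in> H \<theta>" if "\<gamma> \<in> elts omega1" for \<gamma> using closedD[OF closed_H omega1_H that] .
  have cc: "y = check P \<gamma>" if "\<gamma> \<in> elts omega1" "y \<in> H \<theta>" "vpair \<gamma> y \<in> elts c" for \<gamma> y
    by (rule is_check_fun_eq[OF closed_H C c(2) w that(1) wH[OF that(1)] that(2,3)])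
  have ch: "check P \<gamma> \<in> H \<theta> \<and> vpair \<gamma> (check P \<gamma>) \<in> elts c" if "\<gamma> \<in> elts omega1" for \<gamma>
    using c(2) cc that unfolding is_check_fun_def by metis
  note A0 = vset_H[OF cU U order_refl]
  have "is_name_dom (H \<theta>) (vset (pairs B)) M omega1 c"
    unfolding is_name_dom_def A0(2)
  proof (intro conjI ballI impI)
    show "y \<in> pairs B" if "x \<in> pairs B" "y \<in> elts x" for x y using closedD[OF cU that] .
    show "x \<in> pairs B" if "x \<in> elts M" for x using wB(3) that by blast
    show "y \<in> pairs B" if "\<gamma> \<in> elts omega1" "y \<in> H \<theta>" "vpair \<gamma> y \<in> elts c" for \<gamma> y
      using cc[OF that] wB(2) that(1) by blast
  qed
  then have "\<exists>A\<in>elts N. is_name_dom (H \<theta>) A M omega1 c"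
    by (intro reflect[where Q = "\<lambda>A M w c _ _ _. is_name_dom (H \<theta>) A M w c", OF
          definable_is_name_dom[OF closed_H] M omega1_N c(1) M M M A0(1)])
  then obtain A where AN: "A \<in> elts N" and A: "is_name_dom (H \<theta>) A M omega1 c" by blast
  have cA: "closed (elts A)" and MA: "\<And>x. x \<in> elts M \<Longrightarrow> x \<in> elts A"
    and chA: "\<And>\<gamma>. \<gamma> \<in> elts omega1 \<Longrightarrow> check P \<gamma> \<in> elts A"
    using A ch unfolding is_name_dom_def closed_def by auto
  obtain E where EN: "E \<in> elts N" and E: "is_eq_rel E A C R"
    using eq_rel_N[OF leq R AN CR cA] by blast
  have forces: "vpair r (vpair \<tau> (check P \<gamma>)) \<in> elts E \<longleftrightarrow> forces_eq P r \<tau> (check P \<gamma>)"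
    if "\<tau> \<in> elts M" "\<gamma> \<in> elts omega1" "r \<in> elts C" for r \<tau> \<gamma>
    by (rule is_eq_rel_forces_eq[OF leq R cA E MA[OF that(1)] chA[OF that(2)] that(3)])
  have T0C: "T0 \<in> elts C" using T0 R unfolding leq by blast
  have "is_bound (H \<theta>) \<delta>0 omega1 R q M c E"
    unfolding is_bound_def
  proof (intro conjI \<delta>0 bexI[OF _ CH[OF T0C]] ballI impI)
    show "vpair T0 q \<in> elts R" using T0 unfolding leq .
    fix \<tau> \<gamma> y assume h: "\<tau> \<in> elts M" "\<gamma> \<in> elts omega1" "\<delta>0 \<in> elts \<gamma>" "y \<in> H \<theta>" "vpair \<gamma> y \<in> elts c"
    have y: "y = check P \<gamma>" using cc h by blast
    show "\<not> (\<exists>r\<in>H \<theta>. vpair r T0 \<in> elts R \<and> vpair r (vpair \<tau> y) \<in> elts E)"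
    proof
      assume "\<exists>r\<in>H \<theta>. vpair r T0 \<in> elts R \<and> vpair r (vpair \<tau> y) \<in> elts E"
      then obtain r where r: "vpair r T0 \<in> elts R" "vpair r (vpair \<tau> y) \<in> elts E" by blast
      then have "forces_eq P r \<tau> (check P \<gamma>)" using forces[OF h(1,2)] R unfolding y by blast
      then show False using no[OF h(1,2,3)] r(1) unfolding leq by blast
    qed
  qed
  then have "\<exists>\<delta>\<in>elts N. is_bound (H \<theta>) \<delta> omega1 R q M c E"
    by (intro reflect[where Q = "is_bound (H \<theta>)", OF
          definable_is_bound[OF closed_H] omega1_N CR(2) q M c(1) EN wH[OF \<delta>0]])
  then obtain \<delta> T where \<delta>: "\<delta> \<in> elts N" "\<delta> \<in> elts omega1" and T: "vpair T q \<in> elts R"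
    and main: "\<forall>\<tau>\<in>elts M. \<forall>\<gamma>\<in>elts omega1. \<delta> \<in> elts \<gamma> \<longrightarrow> (\<forall>y\<in>H \<theta>. vpair \<gamma> y \<in> elts c \<longrightarrow>
        \<not> (\<exists>r\<in>H \<theta>. vpair r T \<in> elts R \<and> vpair r (vpair \<tau> y) \<in> elts E))"
    unfolding is_bound_def by (elim bexE conjE) (rule that; assumption)
  have "\<not> forces_eq P r \<tau> (check P \<gamma>)"
    if h: "\<tau> \<in> elts M" "\<gamma> \<in> elts omega1" "\<delta> \<in> elts \<gamma>" "leq P r T" for \<tau> \<gamma> r
  proof
    assume F: "forces_eq P r \<tau> (check P \<gamma>)"
    have r: "vpair r T \<in> elts R" using h(4) unfolding leq .
    then have rC: "r \<in> elts C" using R by blast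
    have "vpair r (vpair \<tau> (check P \<gamma>)) \<in> elts E" using forces[OF h(1,2) rC] F by blast
    then show False using main h(1-3) ch[OF h(2)] CH[OF rC] r by blast
  qed
  then show ?thesis using \<delta> T unfolding leq[symmetric] by (intro bexI[of _ \<delta>] exI[of _ T]) auto
qed

end


subsection \<open>Hemi-properness\<close>

lemma forces_Exists:
  "forces P q (Exists i \<phi>) e \<Longrightarrow> leq P T q \<Longrightarrow> \<exists>a s. leq P s T \<and> forces P s \<phi> (e(i := a))"
  by (simp only: forces.simps) blast

text \<open>Otherwise some extension of \<open>T\<close> would put the check name of omega_1
  \<inter> \<open>N\<close> into \<open>gen_ext_name P M\<close>, and a further one would equate it
  with an element of \<open>M\<close>.\<close>

lemma not_forces_exceeds:
  assumes P: "poset P" and T: "leq P T q"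
    and no: "\<And>\<tau> r. \<tau> \<in> elts M \<Longrightarrow> leq P r T \<Longrightarrow>
      \<not> forces_eq P r \<tau> (check P (vset (elts (aleph 1) \<inter> elts N)))"
  shows "\<not> forces P q exceeds_fm (exceeds_env P M N)"
proof
  define d where "d = check P (vset (elts (aleph 1) \<inter> elts N))"
  define e where "e = exceeds_env P M N"
  have e: "e 0 = d" "e 2 = gen_ext_name P M" by (simp_all add: e_def exceeds_env_def d_def)
  have d: "is_name P d" unfolding d_def by (rule is_name_check)
  assume "forces P q exceeds_fm (exceeds_env P M N)"
  from forces_Exists[OF this[folded e_def, unfolded exceeds_fm_def] T]
  obtain a s where s1: "leq P s T" and f: "forces P s
    (And (All 4 (Iff (Mem 4 3) (And (Mem 4 1) (Mem 4 2)))) (Mem 0 3)) (e(3 := a))"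
    by blast
  then have s: "leq P s T" "forces_mem P s d a" and
    all: "forces P s (All 4 (Iff (Mem 4 3) (And (Mem 4 1) (Mem 4 2)))) (e(3 := a))"
    by (simp_all only: forces.simps, simp_all add: e)
  have iff: "forces P s (Iff (Mem 4 3) (And (Mem 4 1) (Mem 4 2))) (e(3 := a, 4 := d))"
    by (rule all[unfolded forces.simps(5), rule_format, OF d])
  have "leq P s s" using poset_refl[OF P leq_conds[OF s(1)]] .
  \<comment> \<open>Implication is coded by negations: as \<open>s\<close> forces the left side,
    some \<open>u\<close> below it forces the right side, of which only membership in
    \<open>M[G]\<close> is kept.\<close>
  then obtain u where u: "leq P u s" "forces_mem P u d (gen_ext_name P M)"
    using iff s(2) by (auto simp: e)
  have "leq P u u" using poset_refl[OF P leq_conds[OF u(1)]] .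
  then obtain r \<sigma> t where r: "vpair \<sigma> t \<in> elts (gen_ext_name P M)" "leq P r u" "forces_eq P r d \<sigma>"
    using forces_mem_step[OF u(2)] by blast
  have "small {vpair \<tau> p |\<tau> p. \<tau> \<in> elts M \<and> is_name P \<tau> \<and> p \<in> conds P}"
    by (rule small_subset[OF small_pairs[of "elts M" "conds P"]]) (auto simp: conds_def)
  then have "\<sigma> \<in> elts M" using r(1) unfolding gen_ext_name_def by (auto simp: elts_vset_small)
  moreover have "leq P r T" using poset_trans[OF P] r(2) u(1) s(1) by blast
  ultimately show False using no forces_eq_sym[OF r(3)] unfolding d_def by blast
qed

theorem theorem19:
  assumes CH: "Pow (elts (aleph 0 :: 'v::zfc_universe)) \<approx> elts (aleph 1 :: 'v)"
  shows "hemi_proper (namba :: 'v)"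
  unfolding hemi_proper_def
proof (intro conjI exI allI impI)
  show "poset (namba :: 'v)" by (rule poset_namba)
  \<comment> \<open>Any regular \<open>\<theta>\<close> above omega_1 is large enough:
    \<open>namba\<close> is in \<open>H \<theta>\<close> through \<open>M\<close>, and the auxiliary
    sets are built over members of \<open>H \<theta>\<close>.\<close>
  show "cardinal (omega1 :: 'v)" by (rule cardinal_omega1)
  fix \<theta> M N q :: 'v
  assume \<theta>: "regular \<theta> \<and> omega1 \<in> elts \<theta>"
    and h: "countable (elts M) \<and> countable (elts N) \<and> elementary (elts M) (H \<theta>) \<and>
      elementary (elts N) (H \<theta>) \<and> namba \<in> elts M \<and> M \<in> elts N \<and> q \<in> conds namba \<inter> elts M"
  have "Ord \<theta>" "omega1 \<in> elts \<theta>" "\<not> elts (omega1 :: 'v) \<approx> elts \<theta>"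
    using \<theta> unfolding regular_def cardinal_def by auto
  then have less: "elts (omega1 :: 'v) \<prec> elts \<theta>"
    using subset_imp_lepoll[OF Ord_mem_subset[of \<theta> omega1]] by (simp add: lesspoll_def)
  have "closed (elts (omega1 :: 'v))"
    using Ord_mem_subset[OF Ord_omega1] unfolding closed_def by blast
  from H_memI[OF this less order_refl] have "omega1 \<in> H \<theta>" .
  then interpret elementary_submodel \<theta> N
    using \<theta> h by unfold_locales (auto simp: regular_def)
  have MN: "elts M \<subseteq> elts N" using countable_subset_N h by blast
  have "elts M \<noteq> {}" using h by blast
  \<comment> \<open>All elements of \<open>M\<close> are listed, names or not.\<close>
  then have M: "range (from_nat_into (elts M)) = elts M" using h by (intro range_from_nat_into) auto
  have "q \<in> conds namba" using h by blast
  from namba_bounded[OF this, of "from_nat_into (elts M)"]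
  obtain \<delta>0 T0 where \<delta>0: "\<delta>0 \<in> elts omega1" and T0: "leq namba T0 q" and
    b: "\<forall>n. \<forall>\<gamma>\<in>elts omega1. \<delta>0 \<in> elts \<gamma> \<longrightarrow>
       \<not> (\<exists>r. leq namba r T0 \<and> forces_eq namba r (from_nat_into (elts M) n) (check namba \<gamma>))"
    by (elim bexE exE conjE) (rule that; assumption)
  have no: "\<not> forces_eq namba r \<tau> (check namba \<gamma>)"
    if "\<tau> \<in> elts M" "\<gamma> \<in> elts omega1" "\<delta>0 \<in> elts \<gamma>" "leq namba r T0" for \<tau> \<gamma> r
  proof -
    have "\<tau> \<in> range (from_nat_into (elts M))" using that(1) M by simp
    then obtain n where "\<tau> = from_nat_into (elts M) n" by (rule rangeE)
    then show ?thesis using b that by blast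
  qed
  obtain C R :: 'v where CR: "namba = vpair C R"
    "elts R \<subseteq> {vpair q p |q p. q \<in> elts C \<and> p \<in> elts C}"
    using namba_vpair by blast
  have "namba \<in> elts N" "q \<in> elts N" "M \<in> elts N" using MN h by auto
  then have "\<exists>\<delta>\<in>elts omega1 \<inter> elts N. \<exists>T. leq namba T q \<and>
      (\<forall>\<tau>\<in>elts M. \<forall>\<gamma>\<in>elts omega1. \<delta> \<in> elts \<gamma> \<longrightarrow>
        (\<forall>r. leq namba r T \<longrightarrow> \<not> forces_eq namba r \<tau> (check namba \<gamma>)))"
    using no by (intro reflect_bound[OF _ CR(1) _ CR(2) _ \<delta>0 T0])
  then obtain \<delta> T where \<delta>: "\<delta> \<in> elts omega1 \<inter> elts N" and T: "leq namba T q" and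
    main: "\<forall>\<tau>\<in>elts M. \<forall>\<gamma>\<in>elts omega1. \<delta> \<in> elts \<gamma> \<longrightarrow>
      (\<forall>r. leq namba r T \<longrightarrow> \<not> forces_eq namba r \<tau> (check namba \<gamma>))"
    by (elim bexE exE conjE) (rule that; assumption)
  \<comment> \<open>This ordinal is the \<open>\<gamma>\<close> to which \<open>main\<close>
    applies; it is above \<open>\<delta>\<close> because \<open>\<delta>\<close> is in
    \<open>N\<close>.\<close>
  have d: "vset (elts omega1 \<inter> elts N) \<in> elts omega1" using omega1_Int_N h by blast
  have "elts (vset (elts omega1 \<inter> elts N)) = elts omega1 \<inter> elts N"
    by (rule elts_vset_small, rule small_subset[OF small_elts[of N]]) blast
  then have "\<delta> \<in> elts (vset (elts omega1 \<inter> elts N))" using \<delta> by simp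
  then show "\<not> forces namba q exceeds_fm (exceeds_env namba M N)"
    using main d by (intro not_forces_exceeds[OF poset_namba T]) (auto simp only: omega1_def)
qed

end
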